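(* Let $\alpha\in(-\pi/2,\pi/2)$, $\Omega\in\mathbb{R}$, $T>0$, and let $z(x,t)=a(x,t)e^{i\Omega t}$ be a solution of $$\frac{dz}{dt}=\frac12 e^{-i\alpha}\mathcal{G}z-\frac12 e^{i\alpha}z^2\,\mathcal{G}\overline{z},\qquad (\ast)$$ where $a(x,t)$ is continuous, $2\pi$-periodic in $x$ and $T$-periodic in $t$. Put $$\omega=\frac{2\pi}{T},\qquad s=\frac{\Omega}{\omega},\qquad u(x,t)=a\left(x,\frac{t}{\omega}\right),\qquad w(x,t)=\frac{e^{-i\alpha}}{2\omega}(\mathcal{G}u)(x,t),$$ and suppose that the amplitude $a$, the primary frequency $\Omega$ and the secondary frequency $\omega$ satisfy the self-consistency equation $$2\omega e^{i\alpha}w(x,t)-\mathcal{G}\,\mathcal{U}(w(x,t),s)=0.$$ Let $\eta(x,t)=i\Omega+e^{i\alpha}a(x,t)(\mathcal{G}\overline{a})(x,t)$, and let $$\sigma_{\mathrm{ess}}=\left\{\exp\left(-\int_0^T\eta(x,t)\,dt\right): x\in[-\pi,\pi]\right\}\cup\left\{\exp\left(-\int_0^T\overline{\eta}(x,t)\,dt\right): x\in[-\pi,\pi]\right\}$$ be the essential spectrum of the monodromy operator $\mathcal{E}(T)$ of the linearization of $(\ast)$ about $z$. Then: (1) $$\exp\left(-\int_0^T\eta(x,t)\,dt\right)=\exp\left(-\int_0^{2\pi}\left(is+2\,\overline{w}(x,t)u(x,t)\right)dt\right).$$ (2) Every $\mu\in\sigma_{\mathrm{ess}}$ lies either on the unit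 circle $|\mu|=1$ or on the interval $(0,1]$ of the real axis. (3) Hence the essential spectrum $\sigma_{\mathrm{ess}}$ cannot be relevant to any instability of the solution $z=a(x,t)e^{i\Omega t}$ obtained from the self-consistency equation. (4) In general, $(\ast)$ may have solutions of the form $z=a(x,t)e^{i\Omega t}$ (with $a$ $T$-periodic in $t$) with unstable essential spectrum, but such solutions do not satisfy the self-consistency equation.
   Context: The coupling kernel $G:\mathbb{R}\to\mathbb{R}$ is a nonconstant continuous even $2\pi$-periodic function, and $(\mathcal{G}u)(x)=\int_{-\pi}^{\pi}G(x-y)u(y)\,dy$, acting in $x$ for each fixed $t$. The operator $\mathcal{U}$ acts in $t$ for each fixed $x$: $\mathcal{U}(w(x,t),s)$ means $\mathcal{U}(w(x,\cdot),s)(t)$. Monodromy operator. Inserting $z=(a+v)e^{i\Omega t}$ into $(\ast)$ and linearizing in $v$ gives $\frac{dv}{dt}=-\eta v+\frac12e^{-i\alpha}\mathcal{G}v-\frac12e^{i\alpha}a^2\mathcal{G}\overline{v}$. Taken together with its complex conjugate, with $(v,\overline v)$ replaced by $(v_1,v_2)$, this is the $T$-periodic linear system $$\frac{dv_1}{dt}=-\eta v_1+\frac12e^{-i\alpha}\mathcal{G}v_1-\frac12e^{i\alpha}a^2\mathcal{G}v_2,\qquad \frac{dv_2}{dt}=-\overline{\eta} v_2+\frac12e^{i\alpha}\mathcal{G}v_2-\frac12e^{-i\alpha}\overline{a}^2\mathcal{G}v_1$$ in the space of continuous $2\pi$-periodic $\mathbb{C}^2$-valued functions of $x$. The monodromy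 operator $\mathcal{E}(T)$ maps the initial value $(v_1,v_2)|_{t=0}$ to $(v_1,v_2)|_{t=T}$. Stability means linear stability; it requires the spectrum of $\mathcal{E}(T)$ to lie in the closed unit disc, and spectrum with $|\mu|>1$ is called unstable. Definition of the solution operator $\mathcal{U}: C_{\mathrm{per}}([0,2\pi];\mathbb{C})\times\mathbb{R}\to C^1_{\mathrm{per}}([0,2\pi];\mathbb{C})$ (spaces of $2\pi$-periodic continuous, resp. $C^1$, functions). Given $(w,s)$, consider the complex Riccati equation $\frac{du}{dt} = w(t) - i s u(t) - \overline{w}(t)u^2(t)$. All solutions starting in the closed unit disc $\overline{\mathbb{D}}$ are global and remain in $\overline{\mathbb{D}}$, and the Poincaré map $u(0)\mapsto u(2\pi)$ on $\overline{\mathbb{D}}$ has the form $\mathcal{M}(u)=\frac{e^{i\theta}(u+b)}{\overline{b}u+1}$ with $|b|<1$, $\theta\in(-\pi,\pi]$. Explicitly, $b=-\zeta$ and $e^{i\theta}=\frac{\overline{\zeta}-1}{\zeta-1}e^{i\chi}$, where $\zeta=U(-2\pi)$ with $U$ the solution of the Riccati equation with $U(0)=0$, and $\chi=\Psi(2\pi)$ with $\Psi$ the solution of $\frac{d\Psi}{dt}=-s+2\,\mathrm{Im}(w(t)e^{-i\Psi})$, $\Psi(0)=0$. Define $u_0$ by: $u_0=0$ if $b=0$; if $b\neq0$, $u_0=\frac{1}{|b|^2}\left(i\sin(\theta/2)+\sqrt{|b|^2-\sin^2(\theta/2)}\right)b e^{i\theta/2}$ when $|b|>|\sin(\theta/2)|$;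 $u_0=\frac{1}{|b|^2}\left(i\sin(\theta/2)-i\sqrt{\sin^2(\theta/2)-|b|^2}\right)b e^{i\theta/2}$ when $|b|\le\sin(\theta/2)$; and $u_0=\frac{1}{|b|^2}\left(i\sin(\theta/2)+i\sqrt{\sin^2(\theta/2)-|b|^2}\right)b e^{i\theta/2}$ when $|b|\le-\sin(\theta/2)$. (For $b\ne0$ this is the unique fixed point of $\mathcal{M}$ in $\overline{\mathbb{D}}$ with $|\mathcal{M}'(u_0)|\le1$.) Then $\mathcal{U}(w,s)$ is the ($2\pi$-periodic) solution $u(t)$ of the Riccati equation with $u(0)=u_0$. *)

theory Defs
  imports "HOL-Analysis.Analysis"
begin

section \<open>The coupling operator and solutions of rotating form\<close>

definition coupling_kernel :: "(real \<Rightarrow> real) \<Rightarrow> bool" where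
  "coupling_kernel G \<longleftrightarrow>
     continuous_on UNIV G \<and> (\<forall>x. G (- x) = G x) \<and> (\<forall>x. G (x + 2 * pi) = G x) \<and>
     (\<exists>x y. G x \<noteq> G y)"

definition coupling :: "(real \<Rightarrow> real) \<Rightarrow> (real \<Rightarrow> complex) \<Rightarrow> real \<Rightarrow> complex" where
  "coupling G u x = integral {- pi..pi} (\<lambda>y. of_real (G (x - y)) * u y)"

definition solves_star :: "(real \<Rightarrow> real) \<Rightarrow> real \<Rightarrow> (real \<Rightarrow> real \<Rightarrow> complex) \<Rightarrow> bool" where
  "solves_star G \<alpha> z \<longleftrightarrow>
     (\<forall>x t. ((\<lambda>t. z x t) has_vector_derivative
        (1 / 2 * exp (- \<i> * of_real \<alpha>) * coupling G (\<lambda>y. z y t) x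
         - 1 / 2 * exp (\<i> * of_real \<alpha>) * (z x t)\<^sup>2 * coupling G (\<lambda>y. cnj (z y t)) x)) (at t))"

definition rotating_solution ::
  "(real \<Rightarrow> real) \<Rightarrow> real \<Rightarrow> real \<Rightarrow> real \<Rightarrow> (real \<Rightarrow> real \<Rightarrow> complex) \<Rightarrow> bool" where
  "rotating_solution G \<alpha> \<Omega> T a \<longleftrightarrow>
     continuous_on UNIV (\<lambda>(x, t). a x t) \<and>
     (\<forall>x t. a (x + 2 * pi) t = a x t) \<and> (\<forall>x t. a x (t + T) = a x t) \<and>
     solves_star G \<alpha> (\<lambda>x t. a x t * exp (\<i> * of_real (\<Omega> * t)))"


section \<open>The solution operator of the periodic complex Riccati equation\<close>

definition riccati :: "(real \<Rightarrow> complex) \<Rightarrow> real \<Rightarrow> (real \<Rightarrow> complex) \<Rightarrow> bool" where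
  "riccati w s u \<longleftrightarrow>
     (\<forall>t. (u has_vector_derivative (w t - \<i> * of_real s * u t - cnj (w t) * (u t)\<^sup>2)) (at t))"

text \<open>For continuous periodic \<open>w\<close> the solution with initial value in the closed unit disc, and the
  phase \<open>\<Psi>\<close> below, exist on the whole real line and are unique, so the descriptions are proper.\<close>

definition riccati_sol :: "(real \<Rightarrow> complex) \<Rightarrow> real \<Rightarrow> complex \<Rightarrow> real \<Rightarrow> complex" where
  "riccati_sol w s c = (THE u. riccati w s u \<and> u 0 = c)"

definition phase_sol :: "(real \<Rightarrow> complex) \<Rightarrow> real \<Rightarrow> real \<Rightarrow> real" where
  "phase_sol w s = (THE \<Psi>. \<Psi> 0 = 0 \<and>
     (\<forall>t. (\<Psi> has_real_derivative (- s + 2 * Im (w t * exp (- \<i> * of_real (\<Psi> t))))) (at t)))"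

definition poincare_zeta :: "(real \<Rightarrow> complex) \<Rightarrow> real \<Rightarrow> complex" where
  "poincare_zeta w s = riccati_sol w s 0 (- 2 * pi)"

definition poincare_b :: "(real \<Rightarrow> complex) \<Rightarrow> real \<Rightarrow> complex" where
  "poincare_b w s = - poincare_zeta w s"

text \<open>\<^const>\<open>Arg\<close> takes values in \<open>(-\<pi>, \<pi>]\<close>, and its argument here has modulus one.\<close>

definition poincare_theta :: "(real \<Rightarrow> complex) \<Rightarrow> real \<Rightarrow> real" where
  "poincare_theta w s =
     Arg ((cnj (poincare_zeta w s) - 1) / (poincare_zeta w s - 1)
          * exp (\<i> * of_real (phase_sol w s (2 * pi))))"

text \<open>The last branch is the case \<open>cmod b \<le> - sin (\<theta> / 2)\<close>.\<close>

definition mobius_fixpoint :: "complex \<Rightarrow> real \<Rightarrow> complex" where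
  "mobius_fixpoint b \<theta> =
     (if b = 0 then 0
      else if cmod b > \<bar>sin (\<theta> / 2)\<bar> then
        1 / of_real ((cmod b)\<^sup>2)
        * (\<i> * of_real (sin (\<theta> / 2)) + of_real (sqrt ((cmod b)\<^sup>2 - (sin (\<theta> / 2))\<^sup>2)))
        * b * exp (\<i> * of_real (\<theta> / 2))
      else if cmod b \<le> sin (\<theta> / 2) then
        1 / of_real ((cmod b)\<^sup>2)
        * (\<i> * of_real (sin (\<theta> / 2)) - \<i> * of_real (sqrt ((sin (\<theta> / 2))\<^sup>2 - (cmod b)\<^sup>2)))
        * b * exp (\<i> * of_real (\<theta> / 2))
      else
        1 / of_real ((cmod b)\<^sup>2)
        * (\<i> * of_real (sin (\<theta> / 2)) + \<i> * of_real (sqrt ((sin (\<theta> / 2))\<^sup>2 - (cmod b)\<^sup>2)))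
        * b * exp (\<i> * of_real (\<theta> / 2)))"

definition sol_op :: "(real \<Rightarrow> complex) \<Rightarrow> real \<Rightarrow> real \<Rightarrow> complex" where
  "sol_op w s = riccati_sol w s (mobius_fixpoint (poincare_b w s) (poincare_theta w s))"


section \<open>The self-consistency equation\<close>

definition sec_freq :: "real \<Rightarrow> real" where
  "sec_freq T = 2 * pi / T"

definition freq_ratio :: "real \<Rightarrow> real \<Rightarrow> real" where
  "freq_ratio \<Omega> T = \<Omega> / sec_freq T"

definition amp_u :: "real \<Rightarrow> (real \<Rightarrow> real \<Rightarrow> complex) \<Rightarrow> real \<Rightarrow> real \<Rightarrow> complex" where
  "amp_u T a x t = a x (t / sec_freq T)"

definition field_w ::
  "(real \<Rightarrow> real) \<Rightarrow> real \<Rightarrow> real \<Rightarrow> (real \<Rightarrow> real \<Rightarrow> complex) \<Rightarrow> real \<Rightarrow> real \<Rightarrow> complex" where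
  "field_w G \<alpha> T a x t =
     exp (- \<i> * of_real \<alpha>) / of_real (2 * sec_freq T) * coupling G (\<lambda>y. amp_u T a y t) x"

definition self_consistent ::
  "(real \<Rightarrow> real) \<Rightarrow> real \<Rightarrow> real \<Rightarrow> real \<Rightarrow> (real \<Rightarrow> real \<Rightarrow> complex) \<Rightarrow> bool" where
  "self_consistent G \<alpha> \<Omega> T a \<longleftrightarrow>
     (\<forall>x t. of_real (2 * sec_freq T) * exp (\<i> * of_real \<alpha>) * field_w G \<alpha> T a x t
            - coupling G (\<lambda>y. sol_op (field_w G \<alpha> T a y) (freq_ratio \<Omega> T) t) x = 0)"


section \<open>The monodromy operator and its essential spectrum\<close>

definition eta ::
  "(real \<Rightarrow> real) \<Rightarrow> real \<Rightarrow> real \<Rightarrow> (real \<Rightarrow> real \<Rightarrow> complex) \<Rightarrow> real \<Rightarrow> real \<Rightarrow> complex" where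
  "eta G \<alpha> \<Omega> a x t =
     \<i> * of_real \<Omega> + exp (\<i> * of_real \<alpha>) * a x t * coupling G (\<lambda>y. cnj (a y t)) x"

definition sigma_ess ::
  "(real \<Rightarrow> real) \<Rightarrow> real \<Rightarrow> real \<Rightarrow> real \<Rightarrow> (real \<Rightarrow> real \<Rightarrow> complex) \<Rightarrow> complex set" where
  "sigma_ess G \<alpha> \<Omega> T a =
     {exp (- integral {0..T} (\<lambda>t. eta G \<alpha> \<Omega> a x t)) | x. x \<in> {- pi..pi}} \<union>
     {exp (- integral {0..T} (\<lambda>t. cnj (eta G \<alpha> \<Omega> a x t))) | x. x \<in> {- pi..pi}}"

definition C_per2 :: "((real \<Rightarrow> complex) \<times> (real \<Rightarrow> complex)) set" where
  "C_per2 = {(f, g). continuous_on UNIV f \<and> (\<forall>x. f (x + 2 * pi) = f x) \<and>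
                     continuous_on UNIV g \<and> (\<forall>x. g (x + 2 * pi) = g x)}"

text \<open>Since \<open>v\<^sub>1, v\<^sub>2\<close> are jointly continuous and periodic in \<open>x\<close>, so are the right-hand sides, and
  the pointwise derivatives in \<open>t\<close> are derivatives with respect to the sup norm in \<open>x\<close>.\<close>

definition linearized_solution ::
  "(real \<Rightarrow> real) \<Rightarrow> real \<Rightarrow> real \<Rightarrow> (real \<Rightarrow> real \<Rightarrow> complex) \<Rightarrow>
   (real \<Rightarrow> real \<Rightarrow> complex) \<Rightarrow> (real \<Rightarrow> real \<Rightarrow> complex) \<Rightarrow> bool" where
  "linearized_solution G \<alpha> \<Omega> a v\<^sub>1 v\<^sub>2 \<longleftrightarrow>
     continuous_on UNIV (\<lambda>(x, t). v\<^sub>1 x t) \<and> continuous_on UNIV (\<lambda>(x, t). v\<^sub>2 x t) \<and>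
     (\<forall>x t. v\<^sub>1 (x + 2 * pi) t = v\<^sub>1 x t) \<and> (\<forall>x t. v\<^sub>2 (x + 2 * pi) t = v\<^sub>2 x t) \<and>
     (\<forall>x t. ((\<lambda>t. v\<^sub>1 x t) has_vector_derivative
        (- eta G \<alpha> \<Omega> a x t * v\<^sub>1 x t
         + 1 / 2 * exp (- \<i> * of_real \<alpha>) * coupling G (\<lambda>y. v\<^sub>1 y t) x
         - 1 / 2 * exp (\<i> * of_real \<alpha>) * (a x t)\<^sup>2 * coupling G (\<lambda>y. v\<^sub>2 y t) x)) (at t)) \<and>
     (\<forall>x t. ((\<lambda>t. v\<^sub>2 x t) has_vector_derivative
        (- cnj (eta G \<alpha> \<Omega> a x t) * v\<^sub>2 x t
         + 1 / 2 * exp (\<i> * of_real \<alpha>) * coupling G (\<lambda>y. v\<^sub>2 y t) x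
         - 1 / 2 * exp (- \<i> * of_real \<alpha>) * (cnj (a x t))\<^sup>2 * coupling G (\<lambda>y. v\<^sub>1 y t) x)) (at t))"

definition monodromy ::
  "(real \<Rightarrow> real) \<Rightarrow> real \<Rightarrow> real \<Rightarrow> real \<Rightarrow> (real \<Rightarrow> real \<Rightarrow> complex) \<Rightarrow>
   (real \<Rightarrow> complex) \<times> (real \<Rightarrow> complex) \<Rightarrow> (real \<Rightarrow> complex) \<times> (real \<Rightarrow> complex)" where
  "monodromy G \<alpha> \<Omega> T a p =
     (THE q. \<exists>v\<^sub>1 v\<^sub>2. linearized_solution G \<alpha> \<Omega> a v\<^sub>1 v\<^sub>2 \<and>
        p = (\<lambda>x. v\<^sub>1 x 0, \<lambda>x. v\<^sub>2 x 0) \<and> q = (\<lambda>x. v\<^sub>1 x T, \<lambda>x. v\<^sub>2 x T))"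

text \<open>Spectrum of the bounded operator \<open>\<E>(T)\<close> on the Banach space \<^const>\<open>C_per2\<close>: by the bounded inverse
  theorem, \<open>\<E>(T) - \<mu>\<close> has a bounded inverse as soon as it is bijective.\<close>

definition monodromy_spectrum ::
  "(real \<Rightarrow> real) \<Rightarrow> real \<Rightarrow> real \<Rightarrow> real \<Rightarrow> (real \<Rightarrow> real \<Rightarrow> complex) \<Rightarrow> complex set" where
  "monodromy_spectrum G \<alpha> \<Omega> T a =
     {\<mu>. \<not> bij_betw (\<lambda>p. (\<lambda>x. fst (monodromy G \<alpha> \<Omega> T a p) x - \<mu> * fst p x,
                         \<lambda>x. snd (monodromy G \<alpha> \<Omega> T a p) x - \<mu> * snd p x)) C_per2 C_per2}"

definition unstable :: "complex \<Rightarrow> bool" where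
  "unstable \<mu> \<longleftrightarrow> cmod \<mu> > 1"

end

(* The function u = a(x, t / omega) solves the Riccati equation of w, and so does the output
   v = U(w, s) of the solution operator. For a periodic solution y put I(y) = Re (integral of cnj w y);
   the multiplier exp (- integral of (is + 2 cnj w y)) has modulus exp (- 2 I(y)). It lies on the unit
   circle if y runs inside the disc or outside of it, and is positive if y runs on the unit circle.
   The branch chosen for v gives I(v) >= 0, and I(u) is either I(v) or - I(v).

   Self-consistency only says G u = G v, not u = v, and the kernel of G may be large. Still, since G is
   symmetric and cnj w is a multiple of cnj (G u), the integral of cnj w (v - u) over x vanishes for
   every t. Hence the nonnegative function I(v) - I(u) has integral 0, and I(u), being continuous in x,
   is nonnegative everywhere. *)
theory Submission
  imports Defs
begin

text \<open>The sign I(v) >= 0 is the condition |M'| <= 1 at the chosen fixed point. In SU(1,1) form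
  the Poincare map has determinant one, so its derivative at c is the inverse square of the
  denominator c q + cnj p at time 2 pi. That denominator is the exponential of the integral of cnj w
  y + is/2 along the solution y starting at c, hence |M'(c)| = exp (- 2 I(y)).

  The obstacle is regularity in x. The initial value of v is given by a case distinction and by
  \<open>Arg\<close>, so v may jump in x although w and u are continuous. Exchanging the integrals
  over x and t therefore rests on joint Borel measurability, read off from a formula for v whose
  coefficients p and q are jointly continuous. They are built by quadratures from the Riccati
  solution u, which also settles their existence.

  The last step of the overview uses I(u) = I(v) or I(u) = - I(v) once more: the negative part of
  I(u) is dominated by I(v) - I(u), so continuity is asked of I(u) alone. The unstable example comes
  from a kernel with negative mean.\<close>

section \<open>Primitives, linear equations and uniqueness\<close>

text \<open>Integrating over the fixed interval \<open>[0, 1]\<close> covers negative \<open>t\<close> as well and makes joint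
  continuity in \<open>t\<close> and a parameter immediate.\<close>

definition primitive :: "(real \<Rightarrow> complex) \<Rightarrow> real \<Rightarrow> complex" where
  "primitive f t = of_real t * integral {0..1} (\<lambda>r. f (t * r))"

lemma primitive_0 [simp]: "primitive f 0 = 0"
  by (simp add: primitive_def)

lemma primitive_eq_integral:
  assumes "0 \<le> t"
  shows "primitive f t = integral {0..t} f"
proof (cases "t = 0")
  case False
  with assms have "t > 0" by simp
  have im: "(\<lambda>x. x / t) ` {0..t} = {0..1}"
    using \<open>t > 0\<close> by (force simp: image_iff divide_simps intro: bexI[of _ "t * _"])
  show ?thesis
    using integral_stretch_real[of t 0 t f] \<open>t > 0\<close>
    by (simp add: im primitive_def scaleR_conv_of_real)
qed simp

lemma primitive_eq_integral_neg:
  assumes "t \<le> 0"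
  shows "primitive f t = - integral {t..0} f"
proof (cases "t = 0")
  case False
  with assms have "t < 0" by simp
  have im: "(\<lambda>x. x / t) ` {t..0} = {0..1}"
  proof
    show "{0..1} \<subseteq> (\<lambda>x. x / t) ` {t..0}"
    proof
      fix x :: real assume "x \<in> {0..1}"
      then have "x = (t * x) / t" "t * x \<in> {t..0}"
        using \<open>t < 0\<close> by (auto simp: mult_le_0_iff mult_le_cancel_left1)
      then show "x \<in> (\<lambda>x. x / t) ` {t..0}" by blast
    qed
  qed (use \<open>t < 0\<close> in \<open>auto simp: divide_simps\<close>)
  show ?thesis
    using integral_stretch_real[of t t 0 f] \<open>t < 0\<close>
    by (simp add: im primitive_def scaleR_conv_of_real)
qed simp

lemma primitive_has_vector_derivative:
  assumes f: "continuous_on UNIV f"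
  shows "(primitive f has_vector_derivative f t) (at t)"
proof -
  \<comment> \<open>With \<open>t\<close> interior to the interval from \<open>- R\<close> to
    \<open>R\<close>, both signs of \<open>r\<close> give one and the same indefinite integral based
    at \<open>- R\<close>, up to a constant.\<close>
  define R where "R = \<bar>t\<bar> + 1"
  have int: "f integrable_on {c..d}" for c d
    using f by (intro integrable_continuous_real) (rule continuous_on_subset, auto)
  have eq: "primitive f r = integral {- R..r} f - integral {- R..0} f" if "r \<in> {- R<..<R}" for r
  proof (cases "0 \<le> r")
    case True
    have "integral {- R..0} f + integral {0..r} f = integral {- R..r} f"
      by (rule Henstock_Kurzweil_Integration.integral_combine) (use True int in \<open>auto simp: R_def\<close>)
    then show ?thesis using True by (simp add: primitive_eq_integral algebra_simps)
  next
    case False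
    have "integral {- R..r} f + integral {r..0} f = integral {- R..0} f"
      by (rule Henstock_Kurzweil_Integration.integral_combine) (use False that int in auto)
    then show ?thesis using False by (simp add: primitive_eq_integral_neg algebra_simps)
  qed
  have "((\<lambda>r. integral {- R..r} f) has_vector_derivative f t) (at t within {- R..R})"
    by (rule integral_has_vector_derivative) (use f in \<open>auto simp: R_def intro: continuous_on_subset\<close>)
  then have "((\<lambda>r. integral {- R..r} f) has_vector_derivative f t) (at t within {- R<..<R})"
    by (rule has_vector_derivative_within_subset) auto
  then have "((\<lambda>r. integral {- R..r} f) has_vector_derivative f t) (at t)"
    by (subst (asm) at_within_open) (auto simp: R_def)
  then have "((\<lambda>r. integral {- R..r} f - integral {- R..0} f) has_vector_derivative f t) (at t)"
    by (auto intro!: derivative_eq_intros)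
  then show ?thesis
    by (rule has_vector_derivative_transform_within_open[where S = "{- R<..<R}"])
       (auto simp: eq R_def)
qed

lemma continuous_on_primitive_param:
  assumes f: "continuous_on UNIV (\<lambda>(x, t). f x t)"
  shows "continuous_on UNIV (\<lambda>(x, t). primitive (f x) t)"
proof -
  have "continuous_on (UNIV \<times> cbox 0 1) (\<lambda>q. (fst (fst q), snd (fst q) * snd q :: real))"
    by (intro continuous_intros)
  then have "continuous_on (UNIV \<times> cbox 0 1) (\<lambda>((x, t), r). f x (t * r))"
    using continuous_on_compose2[OF f] by (fastforce simp: case_prod_unfold)
  then have "continuous_on UNIV (\<lambda>p. integral (cbox 0 1) (\<lambda>r. f (fst p) (snd p * r)))"
    by (intro integral_continuous_on_param) (simp add: case_prod_unfold)
  then show ?thesis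
    by (auto simp: primitive_def case_prod_unfold intro!: continuous_intros)
qed

lemma vector_derivative_zero_imp_const:
  fixes f :: "real \<Rightarrow> 'a::real_normed_vector"
  assumes "\<And>t. (f has_vector_derivative 0) (at t)"
  shows "f t = f s"
proof -
  have "(f has_derivative (\<lambda>h. 0)) (at x within UNIV)" for x
    using assms[of x] by (simp add: has_vector_derivative_def)
  then obtain c where "\<And>x. f x = c"
    using has_derivative_zero_constant[of UNIV f] by auto
  then show ?thesis by simp
qed

lemma has_vector_derivative_exp [derivative_intros]:
  fixes f :: "real \<Rightarrow> complex"
  assumes "(f has_vector_derivative f') (at t)"
  shows "((\<lambda>t. exp (f t)) has_vector_derivative (f' * exp (f t))) (at t)"
  using field_vector_diff_chain_at[OF assms DERIV_exp] by (simp add: o_def)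

lemma has_vector_derivative_quotient:
  fixes f g :: "real \<Rightarrow> complex"
  assumes "(f has_vector_derivative f') (at t)" "(g has_vector_derivative g') (at t)" "g t \<noteq> 0"
  shows "((\<lambda>t. f t / g t) has_vector_derivative ((f' * g t - f t * g') / (g t)\<^sup>2)) (at t)"
proof -
  have "((\<lambda>t. inverse (g t)) has_vector_derivative (g' * - (inverse (g t) ^ Suc (Suc 0)))) (at t)"
    using field_vector_diff_chain_at[OF assms(2) DERIV_inverse[OF assms(3)]] by (simp add: o_def)
  from has_vector_derivative_mult[OF assms(1) this] show ?thesis
    using assms(3) by (simp add: field_simps power2_eq_square)
qed

text \<open>Multiplication by the integrating factor \<open>exp (- primitive g t)\<close> produces a
  function with derivative zero. Uniqueness, invariance of the circle and all period relations below
  are instances of this formula.\<close>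

lemma linear_ode_solution:
  assumes "\<And>t. (d has_vector_derivative (g t * d t)) (at t)" "continuous_on UNIV g"
  shows "d t = d 0 * exp (primitive g t)"
proof -
  have "((\<lambda>t. d t * exp (- primitive g t)) has_vector_derivative 0) (at t)" for t
    by (rule derivative_eq_intros assms primitive_has_vector_derivative refl)+
       (simp add: algebra_simps)
  from vector_derivative_zero_imp_const[OF this, of t 0] show ?thesis
    by (simp add: exp_minus field_simps)
qed

lemma has_vector_derivative_imp_continuous:
  assumes "\<And>t. (f has_vector_derivative f' t) (at t)"
  shows "continuous_on UNIV f"
  using assms by (meson continuous_at_imp_continuous_on has_vector_derivative_continuous)

section \<open>Riccati solutions: uniqueness, invariance of the unit circle, shifts in time\<close>

lemma riccati_continuous: "riccati w s u \<Longrightarrow> continuous_on UNIV u"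
  unfolding riccati_def by (rule has_vector_derivative_imp_continuous) blast

lemma riccati_deriv:
  "riccati w s u \<Longrightarrow> (u has_vector_derivative (w t - \<i> * of_real s * u t - cnj (w t) * (u t)\<^sup>2)) (at t)"
  by (simp add: riccati_def)

text \<open>The quadratic terms factor as (v - u)(v + u), so the difference of two solutions obeys a
  homogeneous linear equation. Equal initial values give uniqueness; different periodic solutions
  give a relation between their multipliers.\<close>

lemma riccati_diff:
  assumes "continuous_on UNIV w" "riccati w s u" "riccati w s v"
  shows "v t - u t = (v 0 - u 0) * exp (primitive (\<lambda>t. - (\<i> * of_real s + cnj (w t) * (u t + v t))) t)"
proof (rule linear_ode_solution)
  show "((\<lambda>t. v t - u t) has_vector_derivative
      - (\<i> * of_real s + cnj (w t) * (u t + v t)) * (v t - u t)) (at t)" for t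
    by (rule derivative_eq_intros riccati_deriv assms refl)+
       (simp add: algebra_simps power2_eq_square)
qed (intro continuous_intros assms riccati_continuous[OF assms(2)] riccati_continuous[OF assms(3)])

lemma riccati_unique:
  assumes "continuous_on UNIV w" "riccati w s u" "riccati w s v" "u 0 = v 0"
  shows "u = v"
  using riccati_diff[OF assms(1-3)] assms(4) by (auto simp: fun_eq_iff)

lemma riccati_sol_eqI:
  assumes "continuous_on UNIV w" "riccati w s u" "u 0 = c"
  shows "riccati_sol w s c = u"
  unfolding riccati_sol_def using assms by (blast intro: the_equality riccati_unique)

text \<open>The term with \<open>s\<close> is a rotation and cancels in the derivative of |u|^2, and
  what remains is divisible by |u|^2 - 1. Hence a solution that starts on the unit circle stays
  there.\<close>

lemma riccati_norm:
  assumes "continuous_on UNIV w" "riccati w s u"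
  shows "u t * cnj (u t) - 1 = (u 0 * cnj (u 0) - 1)
           * exp (primitive (\<lambda>t. - (cnj (w t) * u t + w t * cnj (u t))) t)"
proof (rule linear_ode_solution[where d = "\<lambda>t. u t * cnj (u t) - 1"])
  show "((\<lambda>t. u t * cnj (u t) - 1) has_vector_derivative
      - (cnj (w t) * u t + w t * cnj (u t)) * (u t * cnj (u t) - 1)) (at t)" for t
    by (rule derivative_eq_intros riccati_deriv assms refl)+
       (simp add: algebra_simps power2_eq_square)
qed (intro continuous_intros assms riccati_continuous[OF assms(2)])

lemma riccati_shift:
  assumes "\<And>t. w (t + p) = w t" "riccati w s u"
  shows "riccati w s (\<lambda>t. u (t + p))"
proof -
  have "((\<lambda>t. u (t + p)) has_vector_derivative
      (w t - \<i> * of_real s * u (t + p) - cnj (w t) * (u (t + p))\<^sup>2)) (at t)" for t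
  proof -
    have "((\<lambda>t. t + p) has_vector_derivative 1) (at t)"
      by (auto intro!: derivative_eq_intros)
    from vector_diff_chain_at[OF this riccati_deriv[OF assms(2), of "t + p"]] show ?thesis
      by (simp add: o_def assms(1))
  qed
  then show ?thesis by (simp add: riccati_def)
qed

lemma integrable_primitive:
  fixes f :: "real \<Rightarrow> complex"
  assumes "continuous_on UNIV f"
  shows "(\<lambda>r. f (t * r)) integrable_on {0..1}"
  by (intro integrable_continuous_real continuous_on_compose2[OF assms] continuous_intros) auto

lemma primitive_add:
  assumes "continuous_on UNIV f" "continuous_on UNIV g"
  shows "primitive (\<lambda>t. f t + g t) t = primitive f t + primitive g t"
  unfolding primitive_def
  by (subst integral_add) (auto intro: integrable_primitive assms simp: distrib_left)

lemma primitive_mult_left: "primitive (\<lambda>t. c * f t) t = c * primitive f t"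
  by (simp add: primitive_def)

lemma primitive_const: "primitive (\<lambda>t. c) t = c * of_real t"
  by (simp add: primitive_def)

lemma primitive_cnj: "primitive (\<lambda>t. cnj (f t)) t = cnj (primitive f t)"
  by (simp add: primitive_def integral_cnj)

section \<open>Multipliers of periodic Riccati solutions\<close>

text \<open>Off the unit circle, |u|^2 - 1 is nonzero and returns to itself after a period, so its
  growth factor exp (- 2 Re P) equals 1 and the multiplier has modulus one. On the circle 1/u = cnj
  u, so u itself solves a linear equation with purely imaginary coefficient; closing up after a
  period fixes the phase of the multiplier and leaves exp (- 2 Re P), where \<open>nonneg\<close>
  gives the bound 1.\<close>

lemma periodic_riccati_multiplier:
  assumes w: "continuous_on UNIV w" and u: "riccati w s u" and per: "u (2 * pi) = u 0"
    and nonneg: "0 \<le> Re (primitive (\<lambda>t. cnj (w t) * u t) (2 * pi))"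
  defines "\<mu> \<equiv> exp (- integral {0..2 * pi} (\<lambda>t. \<i> * of_real s + 2 * cnj (w t) * u t))"
  shows "cmod \<mu> = 1 \<or> (\<exists>r. 0 < r \<and> r \<le> 1 \<and> \<mu> = of_real r)"
proof -
  note cont = w riccati_continuous[OF u]
  define P where "P = primitive (\<lambda>t. cnj (w t) * u t) (2 * pi)"
  have Pc: "primitive (\<lambda>t. w t * cnj (u t)) (2 * pi) = cnj P"
    unfolding P_def primitive_cnj[symmetric] by simp
  have mu: "\<mu> = exp (- (\<i> * of_real s * of_real (2 * pi) + 2 * P))"
  proof -
    have "integral {0..2 * pi} (\<lambda>t. \<i> * of_real s + 2 * cnj (w t) * u t)
        = primitive (\<lambda>t. \<i> * of_real s + 2 * (cnj (w t) * u t)) (2 * pi)"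
      by (simp add: primitive_eq_integral mult.assoc)
    also have "\<dots> = \<i> * of_real s * of_real (2 * pi) + 2 * P"
      by (subst primitive_add)
         (auto intro!: continuous_intros cont simp: primitive_mult_left primitive_const P_def)
    finally show ?thesis by (simp add: \<mu>_def)
  qed
  have sym: "primitive (\<lambda>t. - (cnj (w t) * u t + w t * cnj (u t))) (2 * pi) = - (P + cnj P)"
  proof -
    have "primitive (\<lambda>t. (-1) * (cnj (w t) * u t + w t * cnj (u t))) (2 * pi) = - (P + cnj P)"
      by (subst primitive_mult_left, subst primitive_add)
         (auto intro!: continuous_intros cont simp: P_def[symmetric] Pc)
    then show ?thesis by simp
  qed
  show ?thesis
  proof (cases "u 0 * cnj (u 0) - 1 = 0")
    case False
    have "exp (- (P + cnj P)) = 1"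
      using riccati_norm[OF w u, of "2 * pi"] False per unfolding sym by simp
    then have "cmod (exp (- (P + cnj P))) = 1" by simp
    then have "Re P = 0" by simp
    then have "cmod \<mu> = 1" by (simp add: mu)
    then show ?thesis ..
  next
    case True
    have unit: "u t * cnj (u t) = 1" for t
      using riccati_norm[OF w u, of t] True by simp
    have ode: "u (2 * pi) = u 0
        * exp (primitive (\<lambda>t. w t * cnj (u t) - \<i> * of_real s - cnj (w t) * u t) (2 * pi))"
    proof (rule linear_ode_solution)
      fix t
      have "w t - \<i> * of_real s * u t - cnj (w t) * (u t)\<^sup>2
          = (w t * cnj (u t) - \<i> * of_real s - cnj (w t) * u t) * u t"
        using unit[of t] by (simp add: algebra_simps power2_eq_square)
      then show "(u has_vector_derivative
          (w t * cnj (u t) - \<i> * of_real s - cnj (w t) * u t) * u t) (at t)"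
        using riccati_deriv[OF u, of t] by simp
    qed (intro continuous_intros cont)
    have split: "primitive (\<lambda>t. w t * cnj (u t) - \<i> * of_real s - cnj (w t) * u t) (2 * pi)
        = cnj P - \<i> * of_real s * of_real (2 * pi) - P"
    proof -
      have "primitive (\<lambda>t. w t * cnj (u t) + (- \<i> * of_real s + (-1) * (cnj (w t) * u t))) (2 * pi)
          = cnj P + (- \<i> * of_real s * of_real (2 * pi) + (-1) * P)"
        by (subst primitive_add, (intro continuous_intros cont)+)+
           (simp add: Pc P_def primitive_const primitive_mult_left[of "-1", simplified])
      then show ?thesis by (simp add: algebra_simps)
    qed
    have "u 0 \<noteq> 0" using unit[of 0] by auto
    then have one: "exp (cnj P - \<i> * of_real s * of_real (2 * pi) - P) = 1"
      using ode per by (simp add: split)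
    have "- (\<i> * of_real s * of_real (2 * pi) + 2 * P)
        = (cnj P - \<i> * of_real s * of_real (2 * pi) - P) + of_real (- 2 * Re P)"
      by (simp add: complex_eq_iff)
    then have "\<mu> = exp (of_real (- 2 * Re P))"
      using one by (simp only: mu exp_add mult_1_left)
    then have "\<mu> = of_real (exp (- 2 * Re P))"
      by (simp only: exp_of_real)
    then show ?thesis
      using nonneg by (intro disjI2 exI[of _ "exp (- 2 * Re P)"]) (simp add: P_def)
  qed
qed

text \<open>At two distinct fixed points of the Poincare map the multipliers are reciprocal.\<close>

lemma periodic_riccati_pair:
  assumes w: "continuous_on UNIV w" and u: "riccati w s u" "u (2 * pi) = u 0"
    and v: "riccati w s v" "v (2 * pi) = v 0"
  shows "Re (primitive (\<lambda>t. cnj (w t) * u t) (2 * pi)) = Re (primitive (\<lambda>t. cnj (w t) * v t) (2 * pi)) \<or>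
    Re (primitive (\<lambda>t. cnj (w t) * u t) (2 * pi)) = - Re (primitive (\<lambda>t. cnj (w t) * v t) (2 * pi))"
proof (cases "u 0 = v 0")
  case True
  then have "u = v" using riccati_unique w u v by blast
  then show ?thesis by simp
next
  case False
  note cont = w riccati_continuous[OF u(1)] riccati_continuous[OF v(1)]
  have "exp (primitive (\<lambda>t. - (\<i> * of_real s + cnj (w t) * (u t + v t))) (2 * pi)) = 1"
    using riccati_diff[OF w u(1) v(1), of "2 * pi"] False u(2) v(2) by simp
  moreover have "primitive (\<lambda>t. - (\<i> * of_real s + cnj (w t) * (u t + v t))) (2 * pi)
     = primitive (\<lambda>t. (-1) * (\<i> * of_real s + (cnj (w t) * u t + cnj (w t) * v t))) (2 * pi)"
    by (simp add: distrib_left)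
  moreover have "primitive (\<lambda>t. (-1) * (\<i> * of_real s + (cnj (w t) * u t + cnj (w t) * v t))) (2 * pi)
     = - (\<i> * of_real s * of_real (2 * pi) + (primitive (\<lambda>t. cnj (w t) * u t) (2 * pi)
         + primitive (\<lambda>t. cnj (w t) * v t) (2 * pi)))"
    by (subst primitive_mult_left, (subst primitive_add, (intro continuous_intros cont)+)+)
       (simp add: primitive_const)
  ultimately have "cmod (exp (- (\<i> * of_real s * of_real (2 * pi) + (primitive (\<lambda>t. cnj (w t) * u t) (2 * pi)
         + primitive (\<lambda>t. cnj (w t) * v t) (2 * pi))))) = 1"
    by (metis norm_one)
  then show ?thesis by simp
qed

section \<open>The Riccati flow in SU(1,1) form\<close>

text \<open>Writing a Riccati solution as N/D linearizes the equation to N' = - (is/2) N + w D, D' =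
  cnj w N + (is/2) D. The pair (p, q) is the solution (N, D) starting at (1, 0). By the conjugation
  symmetry of the system, (cnj q, cnj p) is the one starting at (0, 1), which explains the
  combination in \<open>mobius_flow\<close>.\<close>

definition su11_pair :: "(real \<Rightarrow> complex) \<Rightarrow> real \<Rightarrow> (real \<Rightarrow> complex) \<Rightarrow> (real \<Rightarrow> complex) \<Rightarrow> bool" where
  "su11_pair w s p q \<longleftrightarrow> p 0 = 1 \<and> q 0 = 0 \<and>
     (\<forall>t. (p has_vector_derivative (- (\<i> * of_real s / 2) * p t + w t * q t)) (at t)) \<and>
     (\<forall>t. (q has_vector_derivative (cnj (w t) * p t + \<i> * of_real s / 2 * q t)) (at t))"

definition mobius_flow :: "(real \<Rightarrow> complex) \<Rightarrow> (real \<Rightarrow> complex) \<Rightarrow> complex \<Rightarrow> real \<Rightarrow> complex" where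
  "mobius_flow p q c t = (c * p t + cnj (q t)) / (c * q t + cnj (p t))"

lemma su11_pair_deriv:
  assumes "su11_pair w s p q"
  shows "(p has_vector_derivative (- (\<i> * of_real s / 2) * p t + w t * q t)) (at t)"
    and "(q has_vector_derivative (cnj (w t) * p t + \<i> * of_real s / 2 * q t)) (at t)"
  using assms by (auto simp: su11_pair_def)

lemma su11_pair_det:
  assumes "su11_pair w s p q"
  shows "p t * cnj (p t) - q t * cnj (q t) = 1"
proof -
  have "((\<lambda>t. p t * cnj (p t) - q t * cnj (q t)) has_vector_derivative 0) (at t)" for t
    by (rule derivative_eq_intros su11_pair_deriv[OF assms] refl)+ (simp add: algebra_simps)
  from vector_derivative_zero_imp_const[OF this, of t 0] show ?thesis
    using assms by (simp add: su11_pair_def)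
qed

lemma su11_pair_cmod:
  assumes "su11_pair w s p q"
  shows "(cmod (p t))\<^sup>2 - (cmod (q t))\<^sup>2 = 1"
  using arg_cong[OF su11_pair_det[OF assms, of t], of Re]
  by (simp add: complex_mult_cnj cmod_power2 flip: of_real_add)

text \<open>Since |p|^2 - |q|^2 = 1, the squared moduli of denominator and numerator differ by
  exactly 1 - |c|^2. This keeps the flow inside the closed disc for all times, backward as well as
  forward.\<close>

lemma mobius_flow_bounds:
  assumes "su11_pair w s p q" "cmod c \<le> 1"
  shows "c * q t + cnj (p t) \<noteq> 0" "cmod (mobius_flow p q c t) \<le> 1"
proof -
  have "(cmod (c * q t + cnj (p t)))\<^sup>2 - (cmod (c * p t + cnj (q t)))\<^sup>2
      = ((cmod (p t))\<^sup>2 - (cmod (q t))\<^sup>2) * (1 - (cmod c)\<^sup>2)"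
    unfolding cmod_power2 by (simp add: algebra_simps power2_eq_square)
  then have diff: "(cmod (c * q t + cnj (p t)))\<^sup>2 - (cmod (c * p t + cnj (q t)))\<^sup>2 = 1 - (cmod c)\<^sup>2"
    by (simp add: su11_pair_cmod[OF assms(1)])
  show nz: "c * q t + cnj (p t) \<noteq> 0"
  proof
    assume "c * q t + cnj (p t) = 0"
    then have "cmod (p t) = cmod c * cmod (q t)"
      by (metis add_eq_0_iff2 complex_mod_cnj norm_minus_cancel norm_mult)
    also have "\<dots> \<le> cmod (q t)"
      using assms(2) by (simp add: mult_left_le_one_le)
    finally have "(cmod (p t))\<^sup>2 \<le> (cmod (q t))\<^sup>2" by (rule power_mono) simp
    then show False using su11_pair_cmod[OF assms(1), of t] by linarith
  qed
  have "(cmod c)\<^sup>2 \<le> 1" using assms(2) by (simp add: power_le_one)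
  then have "(cmod (c * p t + cnj (q t)))\<^sup>2 \<le> (cmod (c * q t + cnj (p t)))\<^sup>2"
    using diff by linarith
  then have "cmod (c * p t + cnj (q t)) \<le> cmod (c * q t + cnj (p t))"
    by (rule power2_le_imp_le) simp
  then show "cmod (mobius_flow p q c t) \<le> 1"
    using nz by (simp add: mobius_flow_def norm_divide divide_le_eq_1)
qed

text \<open>The logarithmic derivative is half of the integrand \<open>is + 2 cnj w u\<close> of the
  multiplier. This links the size of the denominator after a period, hence the derivative of the
  Poincare map, to the integral of cnj w u.\<close>

lemma mobius_flow_denom_deriv:
  assumes "su11_pair w s p q" "cmod c \<le> 1"
  shows "((\<lambda>t. c * q t + cnj (p t)) has_vector_derivative
     (cnj (w t) * mobius_flow p q c t + \<i> * of_real s / 2) * (c * q t + cnj (p t))) (at t)"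
proof -
  have "(cnj (w t) * mobius_flow p q c t + \<i> * of_real s / 2) * (c * q t + cnj (p t))
      = cnj (w t) * (c * p t + cnj (q t)) + \<i> * of_real s / 2 * (c * q t + cnj (p t))"
    using mobius_flow_bounds(1)[OF assms, of t] by (simp add: mobius_flow_def distrib_right)
  then show ?thesis
    by - (rule derivative_eq_intros su11_pair_deriv[OF assms(1)] refl | simp add: algebra_simps)+
qed

lemma mobius_flow_riccati:
  assumes "su11_pair w s p q" "cmod c \<le> 1"
  shows "riccati w s (mobius_flow p q c)" "mobius_flow p q c 0 = c"
proof -
  show "mobius_flow p q c 0 = c"
    using assms(1) by (simp add: mobius_flow_def su11_pair_def)
  have "(mobius_flow p q c has_vector_derivative
      w t - \<i> * of_real s * mobius_flow p q c t - cnj (w t) * (mobius_flow p q c t)\<^sup>2) (at t)" for t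
  proof -
    define N D where "N = c * p t + cnj (q t)" and "D = c * q t + cnj (p t)"
    have nz: "D \<noteq> 0" using mobius_flow_bounds(1)[OF assms] by (simp add: D_def)
    have N: "((\<lambda>t. c * p t + cnj (q t)) has_vector_derivative
        (w t * D - \<i> * of_real s / 2 * N)) (at t)"
      by (rule derivative_eq_intros su11_pair_deriv[OF assms(1)] refl |
          simp add: D_def N_def algebra_simps)+
    have D: "((\<lambda>t. c * q t + cnj (p t)) has_vector_derivative
        (cnj (w t) * N + \<i> * of_real s / 2 * D)) (at t)"
      by (rule derivative_eq_intros su11_pair_deriv[OF assms(1)] refl |
          simp add: D_def N_def algebra_simps)+
    have "((w t * D - \<i> * of_real s / 2 * N) * D - N * (cnj (w t) * N + \<i> * of_real s / 2 * D)) / D\<^sup>2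
        = w t - \<i> * of_real s * (N / D) - cnj (w t) * (N / D)\<^sup>2"
      using nz by (simp add: field_simps power2_eq_square)
    with has_vector_derivative_quotient[OF N D] nz show ?thesis
      by (simp add: mobius_flow_def[abs_def] N_def D_def)
  qed
  then show "riccati w s (mobius_flow p q c)" by (simp add: riccati_def)
qed

section \<open>The chosen fixed point\<close>

text \<open>Substituting v = X b c / |b|^2 turns the fixed point equation into a quadratic for X
  with root product - |b|^2, so |X| <= |b| selects a fixed point in the closed disc. As cnj b v = X
  c, the last claim is |M'(v)| <= 1. For |b| > |sin (\<theta>/2)| both roots have modulus |b| and
  the derivative bound is what distinguishes them; otherwise the roots are imaginary and the bound
  holds with equality.\<close>

lemma mobius_fixpoint_factor:
  assumes \<theta>: "\<theta> \<in> {- pi<..pi}" and b: "b \<noteq> 0" "cmod b < 1"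
  defines "c \<equiv> exp (\<i> * of_real (\<theta> / 2))"
  obtains X where "mobius_fixpoint b \<theta> = X * b * c / of_real ((cmod b)\<^sup>2)"
    and "X\<^sup>2 = 2 * \<i> * of_real (sin (\<theta> / 2)) * X + of_real ((cmod b)\<^sup>2)"
    and "cmod X \<le> cmod b" and "1 - (cmod b)\<^sup>2 \<le> (cmod (1 + X * c))\<^sup>2"
proof -
  define \<sigma> C \<beta> where "\<sigma> = sin (\<theta> / 2)" and "C = cos (\<theta> / 2)" and "\<beta> = cmod b"
  \<comment> \<open>The range of \<theta> makes the half-angle cosine nonnegative; this is why the
    positive square root is the right one in the hyperbolic case.\<close>
  have C: "0 \<le> C" unfolding C_def by (rule cos_ge_zero) (use \<theta> in auto)
  have C2: "C\<^sup>2 = 1 - \<sigma>\<^sup>2" by (simp add: C_def \<sigma>_def cos_squared_eq)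
  have \<beta>: "0 < \<beta>" "\<beta> < 1" using b by (auto simp: \<beta>_def)
  have c: "c = Complex C \<sigma>" by (simp add: c_def C_def \<sigma>_def complex_eq_iff Re_exp Im_exp)
  consider (hyp) "\<beta> > \<bar>\<sigma>\<bar>" | (pos) "\<beta> \<le> \<sigma>" | (neg) "\<not> \<beta> > \<bar>\<sigma>\<bar>" "\<not> \<beta> \<le> \<sigma>" by linarith
  then show thesis
  proof cases
    case hyp
    define R where "R = sqrt (\<beta>\<^sup>2 - \<sigma>\<^sup>2)"
    define X where "X = Complex R \<sigma>"
    have "\<sigma>\<^sup>2 \<le> \<beta>\<^sup>2" using hyp \<beta>(1) by (simp add: abs_le_square_iff[symmetric])
    then have R: "0 \<le> R" "R\<^sup>2 = \<beta>\<^sup>2 - \<sigma>\<^sup>2" by (auto simp: R_def)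
    have "(cmod X)\<^sup>2 = \<beta>\<^sup>2" by (simp add: X_def cmod_power2 R)
    then have nX: "cmod X = \<beta>" using \<beta>(1) by (simp add: power2_eq_iff_nonneg)
    \<comment> \<open>The second factor is \<open>c\<close> itself, so the modulus is
      \<open>C + R\<close>; the other root would give \<open>C - R\<close>.\<close>
    have "1 + X * c = of_real (C + R) * Complex C \<sigma>"
      using C2 by (simp add: X_def c complex_eq_iff algebra_simps power2_eq_square)
    then have "(cmod (1 + X * c))\<^sup>2 = (C + R)\<^sup>2 * (C\<^sup>2 + \<sigma>\<^sup>2)"
      by (simp add: norm_mult power_mult_distrib cmod_power2)
    also have "\<dots> = (C + R)\<^sup>2" by (simp add: C2)
    finally have *: "(cmod (1 + X * c))\<^sup>2 = (C + R)\<^sup>2" .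
    have "1 - \<beta>\<^sup>2 = C\<^sup>2 - R\<^sup>2" using C2 R(2) by simp
    also have "\<dots> \<le> (C + R)\<^sup>2" using C R(1) by (simp add: power2_sum)
    finally have der: "1 - \<beta>\<^sup>2 \<le> (cmod (1 + X * c))\<^sup>2" by (simp add: *)
    show thesis
    proof (rule that[of X])
      show "mobius_fixpoint b \<theta> = X * b * c / of_real ((cmod b)\<^sup>2)"
        using hyp b by (simp add: mobius_fixpoint_def \<beta>_def \<sigma>_def R_def X_def c_def
            Complex_eq algebra_simps add_divide_distrib diff_divide_distrib)
      show "X\<^sup>2 = 2 * \<i> * of_real (sin (\<theta> / 2)) * X + of_real ((cmod b)\<^sup>2)"
        using R(2) by (simp add: complex_eq_iff X_def \<sigma>_def \<beta>_def power2_eq_square)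
    qed (use nX der in \<open>auto simp: \<beta>_def\<close>)
  next
    case pos
    define S where "S = sqrt (\<sigma>\<^sup>2 - \<beta>\<^sup>2)"
    define X where "X = Complex 0 (\<sigma> - S)"
    have "\<beta>\<^sup>2 \<le> \<sigma>\<^sup>2" using pos \<beta>(1) by (simp add: power_mono)
    then have S: "0 \<le> S" "S\<^sup>2 = \<sigma>\<^sup>2 - \<beta>\<^sup>2" by (auto simp: S_def)
    have "S \<le> \<sigma>" using S \<beta>(1) pos by (intro power2_le_imp_le[of S \<sigma>]) auto
    \<comment> \<open>This is |X| <= |b| for the imaginary root, checked by comparing
      squares.\<close>
    moreover have "\<sigma> - \<beta> \<le> S"
    proof (rule power2_le_imp_le)
      have "(\<sigma> - \<beta>)\<^sup>2 = S\<^sup>2 - 2 * \<beta> * (\<sigma> - \<beta>)"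
        using S(2) by (simp add: power2_eq_square algebra_simps)
      also have "\<dots> \<le> S\<^sup>2" using \<beta>(1) pos by simp
      finally show "(\<sigma> - \<beta>)\<^sup>2 \<le> S\<^sup>2" .
    qed (rule S(1))
    ultimately have nX: "cmod X \<le> \<beta>"
      by (simp add: X_def complex_norm)
    have "1 + X * c = Complex (1 - \<sigma>\<^sup>2 + \<sigma> * S) ((\<sigma> - S) * C)"
      by (simp add: X_def c complex_eq_iff power2_eq_square algebra_simps)
    then have "(cmod (1 + X * c))\<^sup>2 = (1 - \<sigma>\<^sup>2 + \<sigma> * S)\<^sup>2 + (1 - \<sigma>\<^sup>2) * (\<sigma> - S)\<^sup>2"
      by (simp add: cmod_power2 power_mult_distrib C2)
    also have "\<dots> = (1 - \<sigma>\<^sup>2) + S\<^sup>2"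
      by (simp add: power2_eq_square algebra_simps)
    also have "\<dots> = 1 - \<beta>\<^sup>2" by (simp add: S)
    finally have der: "(cmod (1 + X * c))\<^sup>2 = 1 - \<beta>\<^sup>2" .
    show thesis
    proof (rule that[of X])
      show "mobius_fixpoint b \<theta> = X * b * c / of_real ((cmod b)\<^sup>2)"
        using pos b by (simp add: mobius_fixpoint_def \<beta>_def \<sigma>_def S_def X_def c_def
            Complex_eq algebra_simps add_divide_distrib diff_divide_distrib)
      show "X\<^sup>2 = 2 * \<i> * of_real (sin (\<theta> / 2)) * X + of_real ((cmod b)\<^sup>2)"
        using S(2) by (simp add: complex_eq_iff X_def \<sigma>_def \<beta>_def power2_eq_square algebra_simps)
    qed (use nX der in \<open>auto simp: \<beta>_def\<close>)
  next
    case neg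
    define S where "S = sqrt (\<sigma>\<^sup>2 - \<beta>\<^sup>2)"
    define X where "X = Complex 0 (\<sigma> + S)"
    have neg': "\<beta> \<le> - \<sigma>" using neg by linarith
    have "\<beta>\<^sup>2 \<le> (- \<sigma>)\<^sup>2" using neg' \<beta>(1) by (intro power_mono) auto
    then have S: "0 \<le> S" "S\<^sup>2 = \<sigma>\<^sup>2 - \<beta>\<^sup>2" by (auto simp: S_def)
    have "S \<le> - \<sigma>" using S \<beta>(1) neg' by (intro power2_le_imp_le[of S "- \<sigma>"]) auto
    moreover have "- \<sigma> - \<beta> \<le> S"
    proof (rule power2_le_imp_le)
      have "(- \<sigma> - \<beta>)\<^sup>2 = S\<^sup>2 - 2 * \<beta> * (- \<sigma> - \<beta>)"
        using S(2) by (simp add: power2_eq_square algebra_simps)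
      also have "\<dots> \<le> S\<^sup>2" using \<beta>(1) neg' by simp
      finally show "(- \<sigma> - \<beta>)\<^sup>2 \<le> S\<^sup>2" .
    qed (rule S(1))
    ultimately have nX: "cmod X \<le> \<beta>"
      by (simp add: X_def complex_norm)
    have "1 + X * c = Complex (1 - \<sigma>\<^sup>2 - \<sigma> * S) ((\<sigma> + S) * C)"
      by (simp add: X_def c complex_eq_iff power2_eq_square algebra_simps)
    then have "(cmod (1 + X * c))\<^sup>2 = (1 - \<sigma>\<^sup>2 - \<sigma> * S)\<^sup>2 + (1 - \<sigma>\<^sup>2) * (\<sigma> + S)\<^sup>2"
      by (simp add: cmod_power2 power_mult_distrib C2)
    also have "\<dots> = (1 - \<sigma>\<^sup>2) + S\<^sup>2"
      by (simp add: power2_eq_square algebra_simps)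
    also have "\<dots> = 1 - \<beta>\<^sup>2" by (simp add: S)
    finally have der: "(cmod (1 + X * c))\<^sup>2 = 1 - \<beta>\<^sup>2" .
    show thesis
    proof (rule that[of X])
      show "mobius_fixpoint b \<theta> = X * b * c / of_real ((cmod b)\<^sup>2)"
        using neg b by (simp add: mobius_fixpoint_def \<beta>_def \<sigma>_def S_def X_def c_def
            Complex_eq algebra_simps add_divide_distrib diff_divide_distrib)
      show "X\<^sup>2 = 2 * \<i> * of_real (sin (\<theta> / 2)) * X + of_real ((cmod b)\<^sup>2)"
        using S(2) by (simp add: complex_eq_iff X_def \<sigma>_def \<beta>_def power2_eq_square algebra_simps)
    qed (use nX der in \<open>auto simp: \<beta>_def\<close>)
  qed
qed

lemma mobius_fixpoint:
  fixes b :: complex and \<theta> :: real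
  assumes \<theta>: "\<theta> \<in> {- pi<..pi}" and b: "cmod b < 1"
  defines "v \<equiv> mobius_fixpoint b \<theta>"
  shows "exp (\<i> * of_real \<theta>) * (v + b) = v * (cnj b * v + 1)"
    and "cmod v \<le> 1" and "1 - (cmod b)\<^sup>2 \<le> (cmod (cnj b * v + 1))\<^sup>2"
proof -
  have "exp (\<i> * of_real \<theta>) * (v + b) = v * (cnj b * v + 1) \<and> cmod v \<le> 1 \<and>
    1 - (cmod b)\<^sup>2 \<le> (cmod (cnj b * v + 1))\<^sup>2"
  proof (cases "b = 0")
    case True
    then show ?thesis by (simp add: v_def mobius_fixpoint_def)
  next
    case False
    define c \<sigma> where "c = exp (\<i> * of_real (\<theta> / 2))" and "\<sigma> = complex_of_real (sin (\<theta> / 2))"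
    obtain X where v: "v = X * b * c / of_real ((cmod b)\<^sup>2)"
      and X: "X\<^sup>2 = 2 * \<i> * \<sigma> * X + of_real ((cmod b)\<^sup>2)"
      and le: "cmod X \<le> cmod b" and der: "1 - (cmod b)\<^sup>2 \<le> (cmod (1 + X * c))\<^sup>2"
      unfolding v_def c_def \<sigma>_def using mobius_fixpoint_factor[OF \<theta> False b] by blast
    have bb: "cnj b * b = of_real ((cmod b)\<^sup>2)"
      by (metis complex_norm_square mult.commute)
    have nz: "complex_of_real ((cmod b)\<^sup>2) \<noteq> 0" using False by simp
    have cc: "exp (\<i> * of_real \<theta>) = c * c"
      unfolding c_def exp_add[symmetric] by (simp add: algebra_simps)
    \<comment> \<open>Equivalently c - 1/c = 2 i sin (\<theta>/2): the half angle is what gives the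
      quadratic for X its imaginary linear coefficient.\<close>
    have c2: "c * c = 1 + 2 * \<i> * \<sigma> * c"
    proof -
      define C S where "C = cos (\<theta> / 2)" and "S = sin (\<theta> / 2)"
      have "c = Complex C S" "\<sigma> = of_real S"
        by (simp_all add: c_def C_def S_def \<sigma>_def complex_eq_iff Re_exp Im_exp)
      moreover have "C * C = 1 - S * S"
        using cos_squared_eq[of "\<theta> / 2"] by (simp add: C_def S_def power2_eq_square)
      ultimately show ?thesis by (simp add: complex_eq_iff)
    qed
    have nc: "cmod c = 1" by (simp add: c_def)
    have bv: "cnj b * v = X * c"
    proof -
      have "cnj b * v = X * c * (cnj b * b) / of_real ((cmod b)\<^sup>2)" by (simp add: v)
      then show ?thesis unfolding bb using nz by simp
    qed
    have "cmod v = cmod X / cmod b"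
      using False by (simp add: v norm_mult norm_divide nc power2_eq_square)
    then have "cmod v \<le> 1" using le False by simp
    moreover have "exp (\<i> * of_real \<theta>) * (v + b) = v * (cnj b * v + 1)"
    proof -
      define N where "N = complex_of_real ((cmod b)\<^sup>2)"
      have "v * (cnj b * v + 1) - c * c * (v + b) = b * c / N * (X * (X * c + 1) - c * c * X - c * N)"
        using nz unfolding bv unfolding v N_def[symmetric] by (simp add: field_simps)
      also have "X * (X * c + 1) - c * c * X - c * N = c * (X\<^sup>2 - 2 * \<i> * \<sigma> * X - N)"
        unfolding c2 by (simp add: algebra_simps power2_eq_square)
      also have "X\<^sup>2 - 2 * \<i> * \<sigma> * X - N = 0" using X by (simp add: N_def)
      finally show ?thesis by (simp add: cc)
    qed
    ultimately show ?thesis using der by (simp add: bv add.commute)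
  qed
  then show "exp (\<i> * of_real \<theta>) * (v + b) = v * (cnj b * v + 1)"
    and "cmod v \<le> 1" and "1 - (cmod b)\<^sup>2 \<le> (cmod (cnj b * v + 1))\<^sup>2" by auto
qed

section \<open>The solution operator\<close>

lemma riccati_sol_eq_mobius_flow:
  assumes "continuous_on UNIV w" "su11_pair w s p q" "cmod c \<le> 1"
  shows "riccati_sol w s c = mobius_flow p q c"
  using assms by (intro riccati_sol_eqI mobius_flow_riccati)

text \<open>The right-hand side is the zero of the numerator at 2 pi, that is, the preimage of 0
  under the Poincare map. Shifting the solution through it by one period gives the solution with
  value 0 at time 0, whose value at - 2 pi is that preimage.\<close>

lemma poincare_zeta_eq:
  assumes w: "continuous_on UNIV w" "\<And>t. w (t + 2 * pi) = w t" and pq: "su11_pair w s p q"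
  shows "poincare_zeta w s = - (cnj (q (2 * pi)) / p (2 * pi))"
proof -
  define \<zeta> where "\<zeta> = - (cnj (q (2 * pi)) / p (2 * pi))"
  have det: "(cmod (p (2 * pi)))\<^sup>2 - (cmod (q (2 * pi)))\<^sup>2 = 1" by (rule su11_pair_cmod[OF pq])
  have lt: "cmod (q (2 * pi)) < cmod (p (2 * pi))"
    by (rule power2_less_imp_less) (use det in auto)
  then have nz: "p (2 * pi) \<noteq> 0" by auto
  have \<zeta>: "cmod \<zeta> < 1" using lt nz by (simp add: \<zeta>_def norm_divide)
  define Y where "Y = mobius_flow p q \<zeta>"
  have Y: "riccati w s Y" "Y 0 = \<zeta>"
    using mobius_flow_riccati[OF pq, of \<zeta>] \<zeta> by (auto simp: Y_def)
  have "Y (2 * pi) = 0" using nz by (simp add: Y_def mobius_flow_def \<zeta>_def)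
  moreover have "riccati w s (\<lambda>t. Y (t + 2 * pi))" by (rule riccati_shift[OF w(2) Y(1)])
  ultimately have "riccati_sol w s 0 = (\<lambda>t. Y (t + 2 * pi))"
    using w by (intro riccati_sol_eqI) auto
  then show ?thesis by (simp add: poincare_zeta_def Y \<zeta>_def)
qed

text \<open>A lift \<open>\<Psi>\<close> of a solution on the unit circle solves the phase equation, and conversely
  \<open>exp (\<i> \<Psi>)\<close> solves the Riccati equation; this gives existence and uniqueness of the phase.\<close>

lemma exp_phase_sol:
  assumes w: "continuous_on UNIV w" and Y: "riccati w s Y" "Y 0 = 1"
  shows "exp (\<i> * of_real (phase_sol w s t)) = Y t"
proof -
  have unit: "Y t * cnj (Y t) = 1" for t
    using riccati_norm[OF w Y(1), of t] Y(2) by simp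
  define h where "h t = - s + 2 * Im (w t * cnj (Y t))" for t
  have conth: "continuous_on UNIV (\<lambda>t. complex_of_real (h t))"
    unfolding h_def by (intro continuous_intros w riccati_continuous[OF Y(1)])
  define \<Psi> where "\<Psi> t = Re (primitive (\<lambda>t. of_real (h t)) t)" for t
  have real: "primitive (\<lambda>t. of_real (h t)) t = of_real (\<Psi> t)" for t
  proof -
    have "cnj (primitive (\<lambda>t. of_real (h t)) t) = primitive (\<lambda>t. of_real (h t)) t"
      by (subst primitive_cnj[symmetric]) simp
    then show ?thesis by (simp add: \<Psi>_def complex_eq_iff)
  qed
  have circle: "exp (\<i> * of_real (\<Psi> t)) = Y t" for t
  proof -
    have "Y t = Y 0 * exp (primitive (\<lambda>t. \<i> * of_real (h t)) t)"
    proof (rule linear_ode_solution)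
      fix t
      have "\<i> * of_real (h t) = w t * cnj (Y t) - \<i> * of_real s - cnj (w t) * Y t"
        by (simp add: h_def complex_eq_iff)
      moreover have "(w t * cnj (Y t) - \<i> * of_real s - cnj (w t) * Y t) * Y t
          = w t - \<i> * of_real s * Y t - cnj (w t) * (Y t)\<^sup>2"
        using unit[of t] by (simp add: algebra_simps power2_eq_square)
      ultimately show "(Y has_vector_derivative \<i> * of_real (h t) * Y t) (at t)"
        using riccati_deriv[OF Y(1), of t] by simp
    qed (intro continuous_intros conth)
    then show ?thesis by (simp add: Y(2) primitive_mult_left real)
  qed
  have "phase_sol w s = \<Psi>"
    unfolding phase_sol_def
  proof (rule the_equality, safe)
    show "\<Psi> 0 = 0" by (simp add: \<Psi>_def)
    fix t
    have "((\<lambda>t. complex_of_real (\<Psi> t)) has_vector_derivative of_real (h t)) (at t)"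
      using primitive_has_vector_derivative[OF conth, of t] by (simp add: real[abs_def])
    then have "(\<Psi> has_real_derivative h t) (at t)"
      by (simp add: has_vector_derivative_complex_iff has_real_derivative_iff_has_vector_derivative)
    moreover have "exp (- \<i> * of_real (\<Psi> t)) = cnj (Y t)"
      by (simp add: circle[symmetric] exp_cnj)
    ultimately show "(\<Psi> has_real_derivative - s + 2 * Im (w t * exp (- \<i> * of_real (\<Psi> t)))) (at t)"
      by (simp add: h_def)
  next
    fix \<Phi> assume 0: "\<Phi> 0 = 0"
      and ode: "\<forall>t. (\<Phi> has_real_derivative - s + 2 * Im (w t * exp (- \<i> * of_real (\<Phi> t)))) (at t)"
    define Z where "Z t = exp (\<i> * of_real (\<Phi> t))" for t
    have cZ: "exp (- \<i> * of_real (\<Phi> t)) = cnj (Z t)" for t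
      by (simp add: Z_def exp_cnj)
    have uZ: "Z t * cnj (Z t) = 1" for t
      unfolding cZ[symmetric] by (simp add: Z_def exp_minus)
    have D\<Phi>: "(\<Phi> has_real_derivative - s + 2 * Im (w t * cnj (Z t))) (at t)" for t
      using ode[rule_format, of t] unfolding cZ .
    have "riccati w s Z"
      unfolding riccati_def
    proof
      fix t
      have "((\<lambda>t. complex_of_real (\<Phi> t)) has_vector_derivative of_real (- s + 2 * Im (w t * cnj (Z t)))) (at t)"
        using D\<Phi>[of t] by (simp add: has_vector_derivative_complex_iff has_real_derivative_iff_has_vector_derivative)
      then have "(Z has_vector_derivative
          (\<i> * of_real (- s + 2 * Im (w t * cnj (Z t))) * Z t)) (at t)"
        unfolding Z_def[abs_def] by (intro has_vector_derivative_exp has_vector_derivative_mult_right)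
      moreover have "\<i> * of_real (- s + 2 * Im (w t * cnj (Z t)))
          = w t * cnj (Z t) - \<i> * of_real s - cnj (w t) * Z t"
        by (simp add: complex_eq_iff)
      moreover have "(w t * cnj (Z t) - \<i> * of_real s - cnj (w t) * Z t) * Z t
          = w t - \<i> * of_real s * Z t - cnj (w t) * (Z t)\<^sup>2"
        using uZ[of t] by (simp add: algebra_simps power2_eq_square)
      ultimately show "(Z has_vector_derivative
          (w t - \<i> * of_real s * Z t - cnj (w t) * (Z t)\<^sup>2)) (at t)" by simp
    qed
    then have "Z = Y"
      using riccati_unique[OF w _ Y(1)] Y(2) 0 by (simp add: Z_def)
    have D\<Psi>: "(\<Psi> has_real_derivative h t) (at t)" for t
    proof -
      have "((\<lambda>t. complex_of_real (\<Psi> t)) has_vector_derivative of_real (h t)) (at t)"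
        using primitive_has_vector_derivative[OF conth, of t] by (simp add: real[abs_def])
      then show ?thesis
        by (simp add: has_vector_derivative_complex_iff has_real_derivative_iff_has_vector_derivative)
    qed
    have "((\<lambda>t. \<Phi> t - \<Psi> t) has_vector_derivative 0) (at t)" for t
      using DERIV_diff[OF D\<Phi>[of t] D\<Psi>[of t]] \<open>Z = Y\<close>
      by (simp add: h_def has_real_derivative_iff_has_vector_derivative)
    then have "\<Phi> t - \<Psi> t = \<Phi> 0 - \<Psi> 0" for t by (rule vector_derivative_zero_imp_const)
    then show "\<Phi> = \<Psi>" using 0 by (auto simp: \<Psi>_def fun_eq_iff)
  qed
  then show ?thesis by (simp add: circle)
qed

text \<open>With A = p and B = cnj q at 2 pi, the solution starting at 1 ends at (A + B) / (cnj A +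
  cnj B), and the prefactor with \<zeta> cancels both sums. What is left, A / cnj A, is the rotation
  factor of (A u + B) / (cnj B u + cnj A) in its normal form with b = B / A.\<close>

lemma poincare_theta_eq:
  assumes w: "continuous_on UNIV w" "\<And>t. w (t + 2 * pi) = w t" and pq: "su11_pair w s p q"
  shows "poincare_theta w s = Arg (p (2 * pi) / cnj (p (2 * pi)))"
proof -
  define A B where "A = p (2 * pi)" and "B = cnj (q (2 * pi))"
  have lt: "cmod B < cmod A"
    by (rule power2_less_imp_less) (use su11_pair_cmod[OF pq, of "2 * pi"] in \<open>auto simp: A_def B_def\<close>)
  then have nz: "A \<noteq> 0" "A + B \<noteq> 0" "cnj A + cnj B \<noteq> 0"
    by (auto simp: add_eq_0_iff2 simp flip: complex_cnj_add)
  have "exp (\<i> * of_real (phase_sol w s (2 * pi))) = mobius_flow p q 1 (2 * pi)"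
    using mobius_flow_riccati[OF pq, of 1] by (intro exp_phase_sol w(1)) auto
  also have "\<dots> = (A + B) / (cnj A + cnj B)"
    by (simp add: mobius_flow_def A_def B_def add.commute)
  finally have ph: "exp (\<i> * of_real (phase_sol w s (2 * pi))) = (A + B) / (cnj A + cnj B)" .
  have "poincare_zeta w s = - (B / A)"
    using poincare_zeta_eq[OF w pq] by (simp add: A_def B_def)
  then have "cnj (poincare_zeta w s) - 1 = - ((cnj A + cnj B) / cnj A)" "poincare_zeta w s - 1 = - ((A + B) / A)"
    using nz by (simp_all add: add_divide_distrib)
  then have K: "(cnj (poincare_zeta w s) - 1) / (poincare_zeta w s - 1) = ((cnj A + cnj B) / cnj A) / ((A + B) / A)"
    by (simp only: divide_minus_left divide_minus_right minus_minus)
  have "(cnj (poincare_zeta w s) - 1) / (poincare_zeta w s - 1)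
      * exp (\<i> * of_real (phase_sol w s (2 * pi))) = A / cnj A"
    unfolding ph K using nz by simp
  then show ?thesis by (simp add: poincare_theta_def A_def)
qed

text \<open>The initial value is expressed through p and q at 2 pi alone, so that its dependence on
  a parameter can be read off from theirs.\<close>

definition sol_op_init :: "(real \<Rightarrow> complex) \<Rightarrow> (real \<Rightarrow> complex) \<Rightarrow> complex" where
  "sol_op_init p q = mobius_fixpoint (cnj (q (2 * pi)) / p (2 * pi)) (Arg (p (2 * pi) / cnj (p (2 * pi))))"

text \<open>All three facts are \<open>mobius_fixpoint\<close> rescaled by cnj A with A = p at 2 pi.
  Because |A|^2 (1 - |b|^2) = 1, the derivative bound becomes the lower bound 1 for the
  denominator.\<close>

lemma sol_op_init:
  assumes pq: "su11_pair w s p q"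
  shows "cmod (sol_op_init p q) \<le> 1"
    and "mobius_flow p q (sol_op_init p q) (2 * pi) = sol_op_init p q"
    and "1 \<le> cmod (sol_op_init p q * q (2 * pi) + cnj (p (2 * pi)))"
proof -
  define A B where "A = p (2 * pi)" and "B = cnj (q (2 * pi))"
  define b \<theta> v where "b = B / A" and "\<theta> = Arg (A / cnj A)" and "v = sol_op_init p q"
  have det: "(cmod A)\<^sup>2 - (cmod B)\<^sup>2 = 1"
    using su11_pair_cmod[OF pq, of "2 * pi"] by (simp add: A_def B_def)
  have lt: "cmod B < cmod A"
    by (rule power2_less_imp_less) (use det in auto)
  then have nz: "A \<noteq> 0" by auto
  have v: "v = mobius_fixpoint b \<theta>"
    by (simp add: v_def sol_op_init_def b_def \<theta>_def A_def B_def)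
  have \<theta>: "\<theta> \<in> {- pi<..pi}" by (simp add: \<theta>_def mpi_less_Arg Arg_le_pi)
  have b: "cmod b < 1" using lt nz by (simp add: b_def norm_divide)
  have "A / cnj A = exp (\<i> * of_real \<theta>)"
    using complex_norm_eq_1_exp_eq[of "A / cnj A"] nz by (simp add: \<theta>_def norm_divide)
  with mobius_fixpoint[OF \<theta> b, folded v]
  have fp: "A / cnj A * (v + b) = v * (cnj b * v + 1)" and le: "cmod v \<le> 1"
    and der: "1 - (cmod b)\<^sup>2 \<le> (cmod (cnj b * v + 1))\<^sup>2" by auto
  show le': "cmod (sol_op_init p q) \<le> 1" using le by (simp add: v_def)
  have den: "v * cnj B + cnj A = cnj A * (cnj b * v + 1)"
    using nz by (simp add: b_def algebra_simps)
  have num: "v * A + B = cnj A * (A / cnj A * (v + b))"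
    using nz by (simp add: b_def algebra_simps)
  have "v * cnj B + cnj A \<noteq> 0"
    using mobius_flow_bounds(1)[OF pq le, of "2 * pi"] by (simp add: A_def B_def)
  then have "(v * A + B) / (v * cnj B + cnj A) = v"
    unfolding num fp den by simp
  then show "mobius_flow p q (sol_op_init p q) (2 * pi) = sol_op_init p q"
    by (simp add: mobius_flow_def v_def A_def B_def)
  have "(cmod A)\<^sup>2 * (1 - (cmod b)\<^sup>2) = 1"
    using det nz by (simp add: b_def norm_divide power_divide right_diff_distrib)
  then have "1 \<le> (cmod A)\<^sup>2 * (cmod (cnj b * v + 1))\<^sup>2"
    using mult_left_mono[OF der, of "(cmod A)\<^sup>2"] by simp
  also have "\<dots> = (cmod (v * cnj B + cnj A))\<^sup>2"
    by (simp add: den norm_mult power_mult_distrib)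
  finally have "1\<^sup>2 \<le> (cmod (v * cnj B + cnj A))\<^sup>2" by simp
  then have "1 \<le> cmod (v * cnj B + cnj A)" by (rule power2_le_imp_le) simp
  then show "1 \<le> cmod (sol_op_init p q * q (2 * pi) + cnj (p (2 * pi)))"
    by (simp add: v_def A_def B_def)
qed

lemma sol_op_eq:
  assumes w: "continuous_on UNIV w" "\<And>t. w (t + 2 * pi) = w t" and pq: "su11_pair w s p q"
  shows "sol_op w s = mobius_flow p q (sol_op_init p q)"
  unfolding sol_op_def poincare_b_def poincare_theta_eq[OF w pq] poincare_zeta_eq[OF w pq]
  using riccati_sol_eq_mobius_flow[OF w(1) pq sol_op_init(1)[OF pq]] by (simp add: sol_op_init_def)

text \<open>For the sign, the denominator starts at 1 and grows by the exponential of the integral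
  of cnj w v + is/2. Its modulus at 2 pi is the exponential of the real part in question and is at
  least 1 for the chosen fixed point.\<close>

lemma sol_op_properties:
  assumes w: "continuous_on UNIV w" "\<And>t. w (t + 2 * pi) = w t" and pq: "su11_pair w s p q"
  shows "riccati w s (sol_op w s)" and "sol_op w s (2 * pi) = sol_op w s 0"
    and "cmod (sol_op w s t) \<le> 1"
    and "0 \<le> Re (primitive (\<lambda>t. cnj (w t) * sol_op w s t) (2 * pi))"
proof -
  note eq = sol_op_eq[OF w pq] and init = sol_op_init[OF pq]
  note ric = mobius_flow_riccati[OF pq init(1)]
  show sol: "riccati w s (sol_op w s)" and "sol_op w s (2 * pi) = sol_op w s 0"
    and "cmod (sol_op w s t) \<le> 1"
    using ric init(2) mobius_flow_bounds(2)[OF pq init(1)] by (auto simp: eq)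
  let ?v = "sol_op_init p q"
  have cont: "continuous_on UNIV (\<lambda>t. cnj (w t) * sol_op w s t)"
    by (intro continuous_intros w riccati_continuous[OF sol])
  have "?v * q (2 * pi) + cnj (p (2 * pi)) = (?v * q 0 + cnj (p 0)) * exp (primitive
      (\<lambda>t. cnj (w t) * sol_op w s t + \<i> * of_real s / 2) (2 * pi))"
    using mobius_flow_denom_deriv[OF pq init(1)] unfolding eq
    by (intro linear_ode_solution continuous_intros cont[unfolded eq])
  also have "?v * q 0 + cnj (p 0) = 1" using pq by (simp add: su11_pair_def)
  finally have "cmod (?v * q (2 * pi) + cnj (p (2 * pi)))
      = exp (Re (primitive (\<lambda>t. cnj (w t) * sol_op w s t + \<i> * of_real s / 2) (2 * pi)))"
    by simp
  also have "primitive (\<lambda>t. cnj (w t) * sol_op w s t + \<i> * of_real s / 2) (2 * pi)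
      = primitive (\<lambda>t. cnj (w t) * sol_op w s t) (2 * pi) + \<i> * of_real s / 2 * of_real (2 * pi)"
    by (subst primitive_add) (auto intro!: continuous_intros cont simp: primitive_const[of "\<i> * of_real s / 2"])
  finally show "0 \<le> Re (primitive (\<lambda>t. cnj (w t) * sol_op w s t) (2 * pi))"
    using init(3) by simp
qed

text \<open>This is the denominator D belonging to the solution u, normalized to 1 at time 0.
  Starting from a known u, everything that follows is a formula in primitives, and these depend
  continuously on a parameter. The summand \<open>1 / pair_exp\<close> in \<open>pair_p\<close>
  makes the determinant with the first solution equal to 1.\<close>

definition pair_exp :: "(real \<Rightarrow> complex) \<Rightarrow> real \<Rightarrow> (real \<Rightarrow> complex) \<Rightarrow> real \<Rightarrow> complex" where
  "pair_exp w s u t = exp (primitive (\<lambda>t. cnj (w t) * u t + \<i> * of_real s / 2) t)"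

definition pair_int :: "(real \<Rightarrow> complex) \<Rightarrow> real \<Rightarrow> (real \<Rightarrow> complex) \<Rightarrow> real \<Rightarrow> complex" where
  "pair_int w s u t = primitive (\<lambda>t. cnj (w t) / (pair_exp w s u t)\<^sup>2) t"

definition pair_p :: "(real \<Rightarrow> complex) \<Rightarrow> real \<Rightarrow> (real \<Rightarrow> complex) \<Rightarrow> real \<Rightarrow> complex" where
  "pair_p w s u t = pair_int w s u t * u t * pair_exp w s u t + 1 / pair_exp w s u t"

definition pair_q :: "(real \<Rightarrow> complex) \<Rightarrow> real \<Rightarrow> (real \<Rightarrow> complex) \<Rightarrow> real \<Rightarrow> complex" where
  "pair_q w s u t = pair_int w s u t * pair_exp w s u t"

text \<open>Reduction of order: \<open>(u E, E)\<close> with \<open>E = pair_exp w s u\<close> solves the linear system, and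
  \<open>(pair_p, pair_q)\<close> is the second solution obtained from it.\<close>

lemma su11_pair_pair:
  assumes w: "continuous_on UNIV w" and u: "riccati w s u"
  shows "su11_pair w s (pair_p w s u) (pair_q w s u)"
proof -
  define E where "E = pair_exp w s u"
  define J where "J = pair_int w s u"
  have nz [simp]: "E t \<noteq> 0" for t by (simp add: E_def pair_exp_def)
  note cont = w riccati_continuous[OF u]
  have E: "(E has_vector_derivative ((cnj (w t) * u t + \<i> * of_real s / 2) * E t)) (at t)" for t
    unfolding E_def pair_exp_def[abs_def]
    by (intro has_vector_derivative_exp primitive_has_vector_derivative continuous_intros cont) simp
  have contE: "continuous_on UNIV E" using E by (rule has_vector_derivative_imp_continuous)
  have J: "(J has_vector_derivative (cnj (w t) / (E t)\<^sup>2)) (at t)" for t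
    unfolding J_def pair_int_def[abs_def] E_def[symmetric]
    by (rule primitive_has_vector_derivative) (auto intro!: continuous_intros cont contE)
  have IE: "((\<lambda>t. 1 / E t) has_vector_derivative (- (cnj (w t) * u t + \<i> * of_real s / 2) / E t)) (at t)" for t
    by (rule has_vector_derivative_eq_rhs[OF has_vector_derivative_quotient[OF has_vector_derivative_const E nz]])
       (simp add: power2_eq_square divide_simps)
  have "((\<lambda>t. J t * u t * E t + 1 / E t) has_vector_derivative
      - (\<i> * of_real s / 2) * (J t * u t * E t + 1 / E t) + w t * (J t * E t)) (at t)" for t
    by (rule has_vector_derivative_eq_rhs,
        (rule has_vector_derivative_add has_vector_derivative_mult J E IE riccati_deriv[OF u])+)
       (simp add: field_simps power2_eq_square)
  moreover have "((\<lambda>t. J t * E t) has_vector_derivative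
      cnj (w t) * (J t * u t * E t + 1 / E t) + \<i> * of_real s / 2 * (J t * E t)) (at t)" for t
    by (rule has_vector_derivative_eq_rhs, (rule has_vector_derivative_mult J E)+)
       (simp add: field_simps power2_eq_square)
  moreover have "E 0 = 1" "J 0 = 0"
    by (simp_all add: E_def J_def pair_exp_def pair_int_def)
  ultimately show ?thesis
    by (simp add: su11_pair_def pair_p_def[abs_def] pair_q_def[abs_def] flip: E_def J_def)
qed

section \<open>Measurable dependence on the space variable\<close>

text \<open>On the negative real axis, where continuity fails, \<open>Arg\<close> is constantly pi.
  A piecewise continuous function thus agrees with it except at the single point 0.\<close>

lemma borel_measurable_Arg [measurable]: "Arg \<in> borel_measurable borel"
proof (rule measurable_discrete_difference)
  show "(\<lambda>z. if z \<in> - \<real>\<^sub>\<le>\<^sub>0 then Arg z else pi) \<in> borel_measurable borel"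
    by (intro borel_measurable_continuous_on_if continuous_on_Arg continuous_on_const) auto
  show "(if z \<in> - \<real>\<^sub>\<le>\<^sub>0 then Arg z else pi) = Arg z" if "z \<notin> {0}" for z
    using that Arg_eq_pi[of z] by (auto simp: complex_nonpos_Reals_iff complex_eq_iff)
qed auto

lemma borel_measurable_mobius_fixpoint [measurable (raw)]:
  assumes [measurable]: "f \<in> borel_measurable M" "g \<in> borel_measurable M"
  shows "(\<lambda>x. mobius_fixpoint (f x) (g x)) \<in> borel_measurable M"
  unfolding mobius_fixpoint_def by measurable

lemma borel_measurable_sol_op_init:
  assumes "\<And>x. p x (2 * pi) \<noteq> 0"
    and "continuous_on UNIV (\<lambda>x::real. p x (2 * pi))" "continuous_on UNIV (\<lambda>x. q x (2 * pi))"
  shows "(\<lambda>x. sol_op_init (p x) (q x)) \<in> borel_measurable borel"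
proof -
  have [measurable]: "(\<lambda>x. cnj (q x (2 * pi)) / p x (2 * pi)) \<in> borel_measurable borel"
    "(\<lambda>x. p x (2 * pi) / cnj (p x (2 * pi))) \<in> borel_measurable borel"
    using assms by (auto intro!: borel_measurable_continuous_onI continuous_intros)
  show ?thesis unfolding sol_op_init_def by measurable
qed

lemma continuous_on_slice:
  assumes "continuous_on UNIV (\<lambda>(x, t). f x t)"
  shows "continuous_on UNIV (f x)" "continuous_on UNIV (\<lambda>x. f x t)"
proof -
  have "continuous_on UNIV (\<lambda>t. (\<lambda>(x, t). f x t) (x, t))"
    by (rule continuous_on_compose2[OF assms])
       (rule continuous_on_Pair continuous_on_const continuous_on_id subset_UNIV)+
  then show "continuous_on UNIV (f x)" by simp
  have "continuous_on UNIV (\<lambda>x. (\<lambda>(x, t). f x t) (x, t))"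
    by (rule continuous_on_compose2[OF assms])
       (rule continuous_on_Pair continuous_on_const continuous_on_id subset_UNIV)+
  then show "continuous_on UNIV (\<lambda>x. f x t)" by simp
qed

section \<open>Integration of bounded Borel functions and exchange of integrals\<close>

lemma set_integrable_bounded_borel:
  fixes f :: "'a::euclidean_space \<Rightarrow> complex"
  assumes "f \<in> borel_measurable borel" "\<And>x. x \<in> cbox a b \<Longrightarrow> cmod (f x) \<le> B"
  shows "set_integrable lborel (cbox a b) f"
proof -
  have "integrable lborel (\<lambda>x. indicator (cbox a b) x *\<^sub>R f x)"
  proof (rule Bochner_Integration.integrable_bound)
    show "integrable lborel (\<lambda>x. indicator (cbox a b) x * \<bar>B\<bar>)"
      by (intro integrable_mult_left integrable_real_indicator) (simp_all add: emeasure_lborel_cbox_finite[simplified])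
    show "(\<lambda>x. indicator (cbox a b) x *\<^sub>R f x) \<in> borel_measurable lborel"
      using assms(1) by measurable
    show "AE x in lborel. norm (indicator (cbox a b) x *\<^sub>R f x) \<le> norm (indicator (cbox a b) x * \<bar>B\<bar>)"
      using order_trans[OF assms(2) abs_ge_self] by (intro AE_I2) (auto simp: indicator_def)
  qed
  then show ?thesis by (simp add: set_integrable_def)
qed

lemma integrable_on_bounded_borel:
  fixes f :: "real \<Rightarrow> complex"
  assumes "f \<in> borel_measurable borel" "\<And>x. x \<in> {a..b} \<Longrightarrow> cmod (f x) \<le> B"
  shows "f integrable_on {a..b}"
  using set_borel_integral_eq_integral(1)[OF set_integrable_bounded_borel, of f a b B] assms by simp

lemma integral_swap_bounded_borel:
  fixes f :: "real \<Rightarrow> real \<Rightarrow> complex"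
  assumes f: "(\<lambda>(x, y). f x y) \<in> borel_measurable borel"
    and bound: "\<And>x y. x \<in> {a..b} \<Longrightarrow> y \<in> {c..d} \<Longrightarrow> cmod (f x y) \<le> B"
  shows "(\<lambda>x. integral {c..d} (f x)) integrable_on {a..b}"
    and "integral {a..b} (\<lambda>x. integral {c..d} (f x)) = integral {c..d} (\<lambda>y. integral {a..b} (\<lambda>x. f x y))"
proof -
  \<comment> \<open>Extension by zero turns the iterated integrals over the rectangle into integrals
    over the whole plane.\<close>
  define g where "g x y = indicator {a..b} x *\<^sub>R indicator {c..d} y *\<^sub>R f x y" for x y
  have fx [measurable]: "(\<lambda>x. f x y) \<in> borel_measurable borel" for y
    using measurable_compose[OF _ f, of "\<lambda>x. (x, y)" borel] by simp
  have fy [measurable]: "f x \<in> borel_measurable borel" for x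
    using measurable_compose[OF _ f, of "\<lambda>y. (x, y)" borel] by simp
  have "set_integrable lborel (cbox (a, c) (b, d)) (\<lambda>(x, y). f x y)"
    by (rule set_integrable_bounded_borel[OF f, where B = B]) (use bound in auto)
  then have int: "integrable (lborel \<Otimes>\<^sub>M lborel) (\<lambda>(x, y). g x y)"
    unfolding set_integrable_def lborel_prod
    by (rule Bochner_Integration.integrable_cong[THEN iffD1, rotated -1])
       (auto simp: g_def indicator_def)
  have iy: "set_integrable lborel {c..d} (f x)" if "x \<in> {a..b}" for x
    using set_integrable_bounded_borel[OF fy, of c d x B] bound that by simp
  have ix: "set_integrable lborel {a..b} (\<lambda>x. f x y)" if "y \<in> {c..d}" for y
    using set_integrable_bounded_borel[OF fx, of a b y B] bound that by simp
  have gy: "(LINT y|lborel. g x y) = indicator {a..b} x *\<^sub>R integral {c..d} (f x)" for x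
    using set_borel_integral_eq_integral(2)[OF iy, of x]
    by (cases "x \<in> {a..b}") (auto simp: g_def set_lebesgue_integral_def)
  have gx: "(LINT x|lborel. g x y) = indicator {c..d} y *\<^sub>R integral {a..b} (\<lambda>x. f x y)" for y
    using set_borel_integral_eq_integral(2)[OF ix, of y]
    by (cases "y \<in> {c..d}") (auto simp: g_def set_lebesgue_integral_def)
  have sx: "set_integrable lborel {a..b} (\<lambda>x. integral {c..d} (f x))"
    using lborel_pair.integrable_fst[OF int] by (simp add: gy set_integrable_def)
  have sy: "set_integrable lborel {c..d} (\<lambda>y. integral {a..b} (\<lambda>x. f x y))"
    using lborel_pair.integrable_snd[OF int] by (simp add: gx set_integrable_def)
  show "(\<lambda>x. integral {c..d} (f x)) integrable_on {a..b}"
    by (rule set_borel_integral_eq_integral(1)[OF sx])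
  show "integral {a..b} (\<lambda>x. integral {c..d} (f x)) = integral {c..d} (\<lambda>y. integral {a..b} (\<lambda>x. f x y))"
    using lborel_pair.Fubini_integral[OF int]
    by (simp add: gx gy set_borel_integral_eq_integral(2)[OF sx, symmetric]
        set_borel_integral_eq_integral(2)[OF sy, symmetric] set_lebesgue_integral_def)
qed

text \<open>The negative part of P lies between 0 and D, so its integral vanishes; being continuous,
  it is zero everywhere. The comparison function D may be as irregular as v makes it.\<close>

lemma nonneg_of_integral_zero_dominating:
  fixes P D :: "real \<Rightarrow> real"
  assumes "a < b" "continuous_on {a..b} P" "D integrable_on {a..b}" "integral {a..b} D = 0"
    and "\<And>x. x \<in> {a..b} \<Longrightarrow> 0 \<le> D x" "\<And>x. x \<in> {a..b} \<Longrightarrow> - P x \<le> D x"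
  shows "\<forall>x\<in>{a..b}. 0 \<le> P x"
proof -
  define N where "N x = max 0 (- P x)" for x
  have N: "continuous_on {a..b} N" unfolding N_def by (intro continuous_intros assms)
  then have intN: "N integrable_on {a..b}" by (rule integrable_continuous_real)
  have "integral {a..b} N \<le> integral {a..b} D"
    by (rule integral_le) (use assms intN in \<open>auto simp: N_def\<close>)
  moreover have "0 \<le> integral {a..b} N"
    by (rule integral_nonneg) (use intN in \<open>auto simp: N_def\<close>)
  ultimately have "integral {a..b} N = 0" using assms(4) by simp
  then have "\<forall>x\<in>{a..b}. N x = 0"
    using integral_eq_0_iff[OF N] assms(1) by (auto simp: N_def)
  then show ?thesis by (auto simp: N_def max_def split: if_splits)
qed

lemma continuous_bounded_on_box:
  assumes "continuous_on UNIV (\<lambda>(x, t). f x t :: complex)"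
  obtains B where "\<And>x t. x \<in> {a..b::real} \<Longrightarrow> t \<in> {c..d::real} \<Longrightarrow> cmod (f x t) \<le> B"
proof -
  have "compact ((\<lambda>(x, t). f x t) ` ({a..b} \<times> {c..d}))"
    by (intro compact_continuous_image continuous_on_subset[OF assms] compact_Times) auto
  then obtain B where "\<forall>z\<in>(\<lambda>(x, t). f x t) ` ({a..b} \<times> {c..d}). cmod z \<le> B"
    using compact_imp_bounded bounded_iff by metis
  then show thesis by (intro that[of B]) auto
qed

section \<open>Families of periodic Riccati solutions parametrized by the space variable\<close>

locale riccati_family =
  fixes w u :: "real \<Rightarrow> real \<Rightarrow> complex" and s :: real
  assumes cont_w: "continuous_on UNIV (\<lambda>(x, t). w x t)"
    and cont_u: "continuous_on UNIV (\<lambda>(x, t). u x t)"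
    and per_w: "w x (t + 2 * pi) = w x t" and per_u: "u x (t + 2 * pi) = u x t"
    and ric: "riccati (w x) s (u x)"
begin

abbreviation p where "p x \<equiv> pair_p (w x) s (u x)"
abbreviation q where "q x \<equiv> pair_q (w x) s (u x)"
abbreviation v where "v x \<equiv> sol_op (w x) s"

lemmas cont_wx = continuous_on_slice(1)[OF cont_w]

lemma pair: "su11_pair (w x) s (p x) (q x)"
  by (intro su11_pair_pair cont_wx ric)

lemmas v_eq = sol_op_eq[OF cont_wx per_w pair]
lemmas v_props = sol_op_properties[OF cont_wx per_w pair]

lemma cont_pair: "continuous_on UNIV (\<lambda>(x, t). p x t)" "continuous_on UNIV (\<lambda>(x, t). q x t)"
proof -
  note c = cont_w[unfolded case_prod_unfold] cont_u[unfolded case_prod_unfold]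
  have "continuous_on UNIV (\<lambda>(x, t). primitive (\<lambda>t. cnj (w x t) * u x t + \<i> * of_real s / 2) t)"
    by (intro continuous_on_primitive_param) (auto simp: case_prod_unfold intro!: continuous_intros c)
  then have E: "continuous_on UNIV (\<lambda>(x, t). pair_exp (w x) s (u x) t)"
    unfolding pair_exp_def case_prod_unfold by (intro continuous_intros)
  have nz: "pair_exp (w x) s (u x) t \<noteq> 0" for x t by (simp add: pair_exp_def)
  note c = c E[unfolded case_prod_unfold]
  have J: "continuous_on UNIV (\<lambda>(x, t). pair_int (w x) s (u x) t)"
    unfolding pair_int_def
    by (intro continuous_on_primitive_param) (auto simp: case_prod_unfold nz intro!: continuous_intros c)
  note c = c J[unfolded case_prod_unfold]
  show "continuous_on UNIV (\<lambda>(x, t). p x t)" "continuous_on UNIV (\<lambda>(x, t). q x t)"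
    unfolding pair_p_def pair_q_def case_prod_unfold by (auto simp: nz intro!: continuous_intros c)
qed

text \<open>Possible jumps in x are confined to the initial value, a Borel function of x through p
  and q at 2 pi. The Moebius quotient then adds only jointly continuous coefficients.\<close>

lemma measurable_v: "(\<lambda>(x, t). v x t) \<in> borel_measurable borel"
proof -
  have "p x t \<noteq> 0" for x t
  proof
    assume "p x t = 0"
    then have "(cmod (q x t))\<^sup>2 = - 1" using su11_pair_cmod[OF pair, of x t] by simp
    with zero_le_power2[of "cmod (q x t)"] show False by linarith
  qed
  then have "(\<lambda>x. sol_op_init (p x) (q x)) \<in> borel_measurable borel"
    by (intro borel_measurable_sol_op_init continuous_on_slice(2)[OF cont_pair(1)]
        continuous_on_slice(2)[OF cont_pair(2)])
  then have [measurable]: "(\<lambda>z::real \<times> real. sol_op_init (p (fst z)) (q (fst z))) \<in> borel_measurable borel"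
    by (rule measurable_compose[rotated]) (simp add: borel_prod[symmetric])
  have [measurable]: "(\<lambda>z. p (fst z) (snd z)) \<in> borel_measurable borel"
    "(\<lambda>z. q (fst z) (snd z)) \<in> borel_measurable borel"
    using cont_pair by (auto intro: borel_measurable_continuous_onI simp: case_prod_unfold)
  have [measurable]: "(\<lambda>z. cnj (p (fst z) (snd z))) \<in> borel_measurable borel"
    "(\<lambda>z. cnj (q (fst z) (snd z))) \<in> borel_measurable borel"
    using cont_pair by (auto intro!: borel_measurable_continuous_onI continuous_intros simp: case_prod_unfold)
  show ?thesis
    unfolding v_eq mobius_flow_def case_prod_unfold by measurable
qed

lemma orthogonal_imp_nonneg:
  assumes orth: "\<And>t. t \<in> {0..2 * pi} \<Longrightarrow>
      integral {- pi..pi} (\<lambda>x. cnj (w x t) * (v x t - u x t)) = 0"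
  shows "\<forall>x\<in>{- pi..pi}. 0 \<le> Re (primitive (\<lambda>t. cnj (w x t) * u x t) (2 * pi))"
proof -
  define P where "P x = Re (primitive (\<lambda>t. cnj (w x t) * u x t) (2 * pi))" for x
  define Q where "Q x = Re (primitive (\<lambda>t. cnj (w x t) * v x t) (2 * pi))" for x
  define f where "f x t = cnj (w x t) * (v x t - u x t)" for x t
  note c = cont_w[unfolded case_prod_unfold] cont_u[unfolded case_prod_unfold]
  have [measurable]: "(\<lambda>z. cnj (w (fst z) (snd z))) \<in> borel_measurable borel"
    "(\<lambda>z. u (fst z) (snd z)) \<in> borel_measurable borel"
    by (auto intro!: borel_measurable_continuous_onI continuous_intros c)
  have [measurable]: "(\<lambda>z. v (fst z) (snd z)) \<in> borel_measurable borel"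
    using measurable_v by (simp add: case_prod_unfold)
  have meas: "(\<lambda>(x, t). f x t) \<in> borel_measurable borel"
    unfolding f_def case_prod_unfold by measurable
  obtain Bw where Bw: "cmod (w x t) \<le> Bw" if "x \<in> {- pi..pi}" "t \<in> {0..2 * pi}" for x t
    using continuous_bounded_on_box[OF cont_w] by metis
  obtain Bu where Bu: "cmod (u x t) \<le> Bu" if "x \<in> {- pi..pi}" "t \<in> {0..2 * pi}" for x t
    using continuous_bounded_on_box[OF cont_u] by metis
  have bound: "cmod (f x t) \<le> Bw * (1 + Bu)" if xt: "x \<in> {- pi..pi}" "t \<in> {0..2 * pi}" for x t
  proof -
    have "cmod (v x t - u x t) \<le> cmod (v x t) + cmod (u x t)" by (rule norm_triangle_ineq4)
    also have "\<dots> \<le> 1 + Bu" by (intro add_mono v_props(3) Bu xt)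
    finally have le: "cmod (v x t - u x t) \<le> 1 + Bu" .
    have "0 \<le> Bw" using Bw[OF xt] norm_ge_zero order_trans by blast
    then show ?thesis unfolding f_def norm_mult complex_mod_cnj
      by (intro mult_mono Bw xt le) auto
  qed
  note swap = integral_swap_bounded_borel[OF meas bound]
  have "integral {- pi..pi} (\<lambda>x. integral {0..2 * pi} (f x))
      = integral {0..2 * pi} (\<lambda>t. integral {- pi..pi} (\<lambda>x. f x t))" by (rule swap(2))
  also have "\<dots> = integral {0..2 * pi} (\<lambda>t. 0)"
    using orth by (intro Henstock_Kurzweil_Integration.integral_cong) (simp add: f_def)
  finally have zero: "integral {- pi..pi} (\<lambda>x. integral {0..2 * pi} (f x)) = 0" by simp
  have QP: "Q x - P x = Re (integral {0..2 * pi} (f x))" for x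
  proof -
    have "f x = (\<lambda>t. cnj (w x t) * v x t + (-1) * (cnj (w x t) * u x t))"
      by (auto simp: f_def algebra_simps)
    then have "integral {0..2 * pi} (f x)
        = primitive (\<lambda>t. cnj (w x t) * v x t + (-1) * (cnj (w x t) * u x t)) (2 * pi)"
      by (simp add: primitive_eq_integral)
    also have "\<dots> = primitive (\<lambda>t. cnj (w x t) * v x t) (2 * pi)
        + (-1) * primitive (\<lambda>t. cnj (w x t) * u x t) (2 * pi)"
      by (subst primitive_add)
         (auto simp: primitive_mult_left[of "-1", simplified] intro!: continuous_intros cont_wx
           riccati_continuous[OF ric] riccati_continuous[OF v_props(1)])
    finally show ?thesis by (simp add: P_def Q_def)
  qed
  have "(\<lambda>x. Re (integral {0..2 * pi} (f x))) integrable_on {- pi..pi}"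
    using integrable_linear[OF swap(1) bounded_linear_Re] by (simp add: o_def)
  moreover have "integral {- pi..pi} (\<lambda>x. Re (integral {0..2 * pi} (f x))) = 0"
    using integral_linear[OF swap(1) bounded_linear_Re] zero by (simp add: o_def)
  moreover have "0 \<le> Q x" "P x = Q x \<or> P x = - Q x" for x
    using v_props(4)[of x] periodic_riccati_pair[OF cont_wx ric _ v_props(1,2), of x] per_u[of x 0]
    by (auto simp: P_def Q_def)
  \<comment> \<open>If P = Q, the difference is 0 and - P = - Q <= 0; if P = - Q, the difference is
    2 Q, which is at least Q = - P.\<close>
  then have "0 \<le> Q x - P x" "- P x \<le> Q x - P x" for x
    by (smt (verit))+
  moreover have "continuous_on UNIV (\<lambda>(x, t). primitive (\<lambda>t. cnj (w x t) * u x t) t)"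
    by (intro continuous_on_primitive_param) (auto simp: case_prod_unfold intro!: continuous_intros c)
  from continuous_on_slice(2)[OF this, of "2 * pi"] have "continuous_on {- pi..pi} P"
    unfolding P_def by (intro continuous_intros) (auto intro: continuous_on_subset)
  ultimately have "\<forall>x\<in>{- pi..pi}. 0 \<le> P x"
    unfolding QP by (intro nonneg_of_integral_zero_dominating) auto
  then show ?thesis by (simp add: P_def)
qed

end

text \<open>Exchange of the integrals together with evenness of the kernel. The second function is
  merely bounded and Borel, since it will be the difference v - u at a fixed time.\<close>

lemma coupling_symmetric:
  assumes G: "coupling_kernel G" and u: "continuous_on UNIV u"
    and d: "d \<in> borel_measurable borel" "\<And>x. x \<in> {- pi..pi} \<Longrightarrow> cmod (d x) \<le> B"
  shows "integral {- pi..pi} (\<lambda>x. cnj (coupling G u x) * d x)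
       = integral {- pi..pi} (\<lambda>y. cnj (u y) * coupling G d y)"
proof -
  define f where "f x y = of_real (G (x - y)) * cnj (u y) * d x" for x y
  have contG: "continuous_on UNIV G" and even: "G (- x) = G x" for x
    using G by (auto simp: coupling_kernel_def)
  have cont: "continuous_on UNIV (\<lambda>(x, y). of_real (G (x - y)) * cnj (u y))"
    unfolding case_prod_unfold
    by (intro continuous_intros continuous_on_compose2[OF contG] continuous_on_compose2[OF u]) auto
  then have "(\<lambda>z. of_real (G (fst z - snd z)) * cnj (u (snd z))) \<in> borel_measurable borel"
    unfolding case_prod_unfold by (rule borel_measurable_continuous_onI)
  moreover have "(\<lambda>z::real \<times> real. d (fst z)) \<in> borel_measurable borel"
    using d(1) by (rule measurable_compose[rotated]) (simp add: borel_prod[symmetric])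
  ultimately have meas: "(\<lambda>(x, y). f x y) \<in> borel_measurable borel"
    unfolding f_def case_prod_unfold by measurable
  obtain C where C: "cmod (of_real (G (x - y)) * cnj (u y)) \<le> C"
    if "x \<in> {- pi..pi}" "y \<in> {- pi..pi}" for x y
    using continuous_bounded_on_box[OF cont] by metis
  have bound: "cmod (f x y) \<le> C * B" if xy: "x \<in> {- pi..pi}" "y \<in> {- pi..pi}" for x y
  proof -
    have "0 \<le> C" using C[OF xy] norm_ge_zero order_trans by blast
    then show ?thesis
      unfolding f_def norm_mult[of _ "d x"] by (intro mult_mono C d(2) xy) auto
  qed
  have "cnj (coupling G u x) * d x = integral {- pi..pi} (f x)" for x
    by (simp add: coupling_def integral_cnj f_def[abs_def])
  moreover have "cnj (u y) * coupling G d y = integral {- pi..pi} (\<lambda>x. f x y)" for y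
    using even[of "y - x" for x]
    by (simp add: coupling_def f_def mult.assoc mult.left_commute[of _ "cnj (u y)"])
  ultimately show ?thesis using integral_swap_bounded_borel(2)[OF meas bound] by simp
qed

section \<open>Rotating solutions\<close>

lemma coupling_mult: "coupling G (\<lambda>y. c * f y) x = c * coupling G f x"
  by (simp add: coupling_def mult.left_commute[of _ c])

lemma cnj_coupling: "cnj (coupling G f x) = coupling G (\<lambda>y. cnj (f y)) x"
  by (simp add: coupling_def integral_cnj)

lemma continuous_on_coupling:
  assumes G: "continuous_on UNIV G" and u: "continuous_on UNIV (\<lambda>(x, t). u x t)"
  shows "continuous_on UNIV (\<lambda>(x, t). coupling G (\<lambda>y. u y t) x)"
proof -
  have "continuous_on (UNIV \<times> cbox (- pi) pi) (\<lambda>z. (snd z, snd (fst z)))"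
    by (intro continuous_intros)
  then have "continuous_on (UNIV \<times> cbox (- pi) pi) (\<lambda>z. u (snd z) (snd (fst z)))"
    using continuous_on_compose2[OF u, of _ "\<lambda>z. (snd z, snd (fst z))"] by simp
  then have "continuous_on (UNIV \<times> cbox (- pi) pi)
      (\<lambda>(p, y). of_real (G (fst p - y)) * u y (snd p))"
    unfolding case_prod_unfold by (intro continuous_intros continuous_on_compose2[OF G]) auto
  from integral_continuous_on_param[OF this] show ?thesis
    by (simp add: coupling_def case_prod_unfold)
qed

lemma sec_freq_pos: "T > 0 \<Longrightarrow> sec_freq T > 0"
  by (simp add: sec_freq_def)

lemma cnj_field_w:
  "cnj (field_w G \<alpha> T a x t)
     = exp (\<i> * of_real \<alpha>) / of_real (2 * sec_freq T) * coupling G (\<lambda>y. cnj (amp_u T a y t)) x"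
  by (simp add: field_w_def cnj_coupling exp_cnj)

text \<open>Both terms on the right of the equation for z pick up exactly one factor
  \<open>exp (\<i> * of_real (\<Omega> * t))\<close> under rotation, the cubic one as e^2 cnj e = e.
  Multiplying by the inverse rotation removes it at the cost of the term with \<Omega>.\<close>

lemma rotating_solution_deriv:
  assumes "rotating_solution G \<alpha> \<Omega> T a"
  shows "(a x has_vector_derivative
      (- \<i> * of_real \<Omega> * a x t + 1 / 2 * exp (- \<i> * of_real \<alpha>) * coupling G (\<lambda>y. a y t) x
       - 1 / 2 * exp (\<i> * of_real \<alpha>) * (a x t)\<^sup>2 * coupling G (\<lambda>y. cnj (a y t)) x)) (at t)"
proof -
  define e where "e t = exp (\<i> * of_real (\<Omega> * t))" for t
  have ce: "e t * exp (- \<i> * of_real (\<Omega> * t)) = 1" "e t * cnj (e t) = 1" for t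
    by (simp_all add: e_def exp_minus exp_cnj)
  have out: "coupling G (\<lambda>y. a y t * e t) x = e t * coupling G (\<lambda>y. a y t) x"
    "coupling G (\<lambda>y. cnj (a y t * e t)) x = cnj (e t) * coupling G (\<lambda>y. cnj (a y t)) x"
    using coupling_mult[of G "e t" "\<lambda>y. a y t" x] coupling_mult[of G "cnj (e t)" "\<lambda>y. cnj (a y t)" x]
    by (simp_all add: mult.commute)
  have "solves_star G \<alpha> (\<lambda>x t. a x t * e t)"
    using assms by (simp add: rotating_solution_def e_def)
  then have z: "((\<lambda>t. a x t * e t) has_vector_derivative
      (1 / 2 * exp (- \<i> * of_real \<alpha>) * (e t * coupling G (\<lambda>y. a y t) x)
       - 1 / 2 * exp (\<i> * of_real \<alpha>) * (a x t * e t)\<^sup>2 * (cnj (e t) * coupling G (\<lambda>y. cnj (a y t)) x))) (at t)"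
    unfolding solves_star_def out[symmetric] by blast
  have lin: "((\<lambda>t. - \<i> * of_real (\<Omega> * t)) has_vector_derivative (- \<i> * of_real \<Omega>)) (at t)"
    by (auto intro!: derivative_eq_intros)
  have "((\<lambda>t. (a x t * e t) * exp (- \<i> * of_real (\<Omega> * t))) has_vector_derivative
      ((a x t * e t) * (- \<i> * of_real \<Omega> * exp (- \<i> * of_real (\<Omega> * t)))
       + (1 / 2 * exp (- \<i> * of_real \<alpha>) * (e t * coupling G (\<lambda>y. a y t) x)
         - 1 / 2 * exp (\<i> * of_real \<alpha>) * (a x t * e t)\<^sup>2 * (cnj (e t) * coupling G (\<lambda>y. cnj (a y t)) x))
         * exp (- \<i> * of_real (\<Omega> * t)))) (at t)"
    by (intro has_vector_derivative_mult z has_vector_derivative_exp lin)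
  moreover have "(\<lambda>t. (a x t * e t) * exp (- \<i> * of_real (\<Omega> * t))) = a x"
    using ce(1) by (simp add: fun_eq_iff mult.assoc)
  moreover define f where "f = exp (- \<i> * of_real (\<Omega> * t))"
  have "(a x t * e t) * (- \<i> * of_real \<Omega> * f)
      + (1 / 2 * exp (- \<i> * of_real \<alpha>) * (e t * c)
         - 1 / 2 * exp (\<i> * of_real \<alpha>) * (a x t * e t)\<^sup>2 * (cnj (e t) * d)) * f
      = (e t * f) * (- \<i> * of_real \<Omega> * a x t + 1 / 2 * exp (- \<i> * of_real \<alpha>) * c
         - (e t * cnj (e t)) * (1 / 2 * exp (\<i> * of_real \<alpha>) * (a x t)\<^sup>2 * d))" for c d
    by (simp add: algebra_simps power2_eq_square)
  ultimately show ?thesis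
    unfolding f_def ce by simp
qed

text \<open>Rescaling time divides the equation for \<open>a\<close> by the secondary frequency, and
  the prefactor of \<open>field_w\<close> is chosen to absorb the coupling terms. The nonlocality is
  hidden in w, leaving an ordinary equation for each x.\<close>

lemma rotating_solution_riccati:
  assumes T: "T > 0" and a: "rotating_solution G \<alpha> \<Omega> T a"
  shows "riccati (field_w G \<alpha> T a x) (freq_ratio \<Omega> T) (amp_u T a x)"
  unfolding riccati_def
proof
  fix t
  define \<omega> where "\<omega> = sec_freq T"
  have \<omega>: "\<omega> > 0" using sec_freq_pos[OF T] by (simp add: \<omega>_def)
  have "((\<lambda>t. t / \<omega>) has_vector_derivative (1 / \<omega>)) (at t)"
    by (auto intro!: derivative_eq_intros)
  note chain = vector_diff_chain_at[OF this rotating_solution_deriv[OF a]]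
  have "((\<lambda>t. a x (t / \<omega>)) has_vector_derivative field_w G \<alpha> T a x t
      - \<i> * of_real (freq_ratio \<Omega> T) * a x (t / \<omega>) - cnj (field_w G \<alpha> T a x t) * (a x (t / \<omega>))\<^sup>2) (at t)"
    unfolding cnj_field_w
    by (rule has_vector_derivative_eq_rhs[OF chain[unfolded o_def]])
       (use \<omega> in \<open>simp add: field_w_def freq_ratio_def amp_u_def \<omega>_def[symmetric]
          scaleR_conv_of_real field_simps\<close>)
  then show "(amp_u T a x has_vector_derivative field_w G \<alpha> T a x t
      - \<i> * of_real (freq_ratio \<Omega> T) * amp_u T a x t - cnj (field_w G \<alpha> T a x t) * (amp_u T a x t)\<^sup>2) (at t)"
    by (simp add: amp_u_def[abs_def] \<omega>_def)
qed

lemma rotating_solution_family: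
  assumes T: "T > 0" and G: "continuous_on UNIV G" and a: "rotating_solution G \<alpha> \<Omega> T a"
  shows "riccati_family (field_w G \<alpha> T a) (amp_u T a) (freq_ratio \<Omega> T)"
proof
  have nz: "sec_freq T \<noteq> 0" using sec_freq_pos[OF T] by simp
  have ac: "continuous_on UNIV (\<lambda>(x, t). a x t)" and per: "a x (t + T) = a x t" for x t
    using a by (auto simp: rotating_solution_def)
  have "continuous_on UNIV (\<lambda>z::real \<times> real. (fst z, snd z / sec_freq T))"
    by (intro continuous_intros) (use nz in auto)
  then show u: "continuous_on UNIV (\<lambda>(x, t). amp_u T a x t)"
    using continuous_on_compose2[OF ac, of UNIV "\<lambda>z. (fst z, snd z / sec_freq T)"]
    by (simp add: amp_u_def case_prod_unfold)
  show "continuous_on UNIV (\<lambda>(x, t). field_w G \<alpha> T a x t)"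
    using continuous_on_coupling[OF G u] nz unfolding field_w_def case_prod_unfold
    by (intro continuous_intros) auto
  have "(t + 2 * pi) / sec_freq T = t / sec_freq T + T" for t
    using T by (simp add: sec_freq_def field_simps)
  then show "amp_u T a x (t + 2 * pi) = amp_u T a x t" for x t
    by (simp add: amp_u_def per)
  then show "field_w G \<alpha> T a x (t + 2 * pi) = field_w G \<alpha> T a x t" for x t
    by (simp add: field_w_def)
qed (rule rotating_solution_riccati[OF T a])

section \<open>The essential spectrum under the self-consistency equation\<close>

lemma integral_eta:
  assumes T: "T > 0"
  shows "integral {0..T} (eta G \<alpha> \<Omega> a x) = integral {0..2 * pi}
    (\<lambda>t. \<i> * of_real (freq_ratio \<Omega> T) + 2 * cnj (field_w G \<alpha> T a x t) * amp_u T a x t)"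
    (is "_ = integral _ ?g")
proof -
  have g: "?g t = eta G \<alpha> \<Omega> a x (t / sec_freq T) / of_real (sec_freq T)" for t
    using sec_freq_pos[OF T] unfolding cnj_field_w
    by (simp add: eta_def freq_ratio_def amp_u_def field_simps)
  have r: "2 * pi * r / sec_freq T = T * r" for r
    using T by (simp add: sec_freq_def)
  \<comment> \<open>Scaled to the unit interval, the integrands differ by the factor T / (2 pi),
    which compensates the different lengths in \<open>primitive\<close>; no separate substitution
    rule is involved.\<close>
  have "?g (2 * pi * r) = of_real (T / (2 * pi)) * eta G \<alpha> \<Omega> a x (T * r)" for r
    unfolding g r by (simp add: sec_freq_def)
  then have "primitive ?g (2 * pi) = primitive (eta G \<alpha> \<Omega> a x) T"
    unfolding primitive_def by simp
  then show ?thesis using T by (simp add: primitive_eq_integral)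
qed

lemma self_consistent_orthogonal:
  assumes T: "T > 0" and G: "coupling_kernel G"
    and a: "rotating_solution G \<alpha> \<Omega> T a" and sc: "self_consistent G \<alpha> \<Omega> T a"
  shows "integral {- pi..pi} (\<lambda>x. cnj (field_w G \<alpha> T a x t)
      * (sol_op (field_w G \<alpha> T a x) (freq_ratio \<Omega> T) t - amp_u T a x t)) = 0"
proof -
  define w u where "w = field_w G \<alpha> T a" and "u = amp_u T a"
  define v where "v x = sol_op (w x) (freq_ratio \<Omega> T)" for x
  define d where "d x = v x t - u x t" for x
  have contG: "continuous_on UNIV G" using G by (simp add: coupling_kernel_def)
  interpret F: riccati_family w u "freq_ratio \<Omega> T"
    unfolding w_def u_def by (rule rotating_solution_family[OF T contG a])
  have ut: "continuous_on UNIV (\<lambda>x. u x t)" by (rule continuous_on_slice(2)[OF F.cont_u])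
  then have um: "(\<lambda>x. u x t) \<in> borel_measurable borel" by (rule borel_measurable_continuous_onI)
  have vm: "(\<lambda>x. v x t) \<in> borel_measurable borel"
    using measurable_compose[OF _ F.measurable_v, of "\<lambda>x. (x, t)" borel] by (simp add: v_def)
  have vb: "cmod (v x t) \<le> 1" for x by (simp add: v_def F.v_props(3))
  obtain B where B: "cmod (u x t) \<le> B" if "x \<in> {- pi..pi}" for x
    using continuous_bounded_on_box[OF F.cont_u, where c = t and d = t] by (metis atLeastAtMost_singleton singletonI)
  have db: "cmod (d x) \<le> 1 + B" if "x \<in> {- pi..pi}" for x
    unfolding d_def using norm_triangle_ineq4[of "v x t" "u x t"] vb[of x] B[OF that] by linarith
  have dm: "d \<in> borel_measurable borel" unfolding d_def using vm um by measurable
  have "coupling G d x = 0" for x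
  \<comment> \<open>Splitting \<open>coupling G d\<close> into a difference presupposes that both
    integrals exist; for v this follows from Borel measurability and the bound 1.\<close>
  proof -
    have Gm: "(\<lambda>y. complex_of_real (G (x - y))) \<in> borel_measurable borel"
      by (intro borel_measurable_continuous_onI continuous_intros continuous_on_compose2[OF contG]) auto
    have "compact ((\<lambda>y. G (x - y)) ` {- pi..pi})"
      by (intro compact_continuous_image continuous_on_compose2[OF contG] continuous_intros) auto
    then obtain C where C: "\<bar>G (x - y)\<bar> \<le> C" if "y \<in> {- pi..pi}" for y
      using compact_imp_bounded bounded_iff by (metis imageI real_norm_def)
    have iu: "(\<lambda>y. of_real (G (x - y)) * u y t) integrable_on {- pi..pi}"
    proof (rule integrable_on_bounded_borel)
      fix y assume y: "y \<in> {- pi..pi}"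
      then have "0 \<le> C" using C abs_ge_zero order_trans by blast
      then show "cmod (of_real (G (x - y)) * u y t) \<le> C * B"
        unfolding norm_mult using C[OF y] B[OF y] by (intro mult_mono) auto
    qed (use Gm um in measurable)
    have iv: "(\<lambda>y. of_real (G (x - y)) * v y t) integrable_on {- pi..pi}"
    proof (rule integrable_on_bounded_borel)
      fix y assume y: "y \<in> {- pi..pi}"
      then have "0 \<le> C" using C abs_ge_zero order_trans by blast
      then show "cmod (of_real (G (x - y)) * v y t) \<le> C * 1"
        unfolding norm_mult using C[OF y] vb[of y] by (intro mult_mono) auto
    qed (use Gm vm in measurable)
    have "coupling G d x = coupling G (\<lambda>y. v y t) x - coupling G (\<lambda>y. u y t) x"
      unfolding coupling_def d_def right_diff_distrib
      by (rule Henstock_Kurzweil_Integration.integral_diff[OF iv iu])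
    also have "coupling G (\<lambda>y. v y t) x = of_real (2 * sec_freq T) * exp (\<i> * of_real \<alpha>) * w x t"
      using sc by (simp add: self_consistent_def v_def w_def)
    also have "\<dots> = coupling G (\<lambda>y. u y t) x"
      using sec_freq_pos[OF T] by (simp add: w_def u_def field_w_def exp_minus)
    finally show ?thesis by simp
  qed
  then have "integral {- pi..pi} (\<lambda>x. cnj (coupling G (\<lambda>y. u y t) x) * d x) = 0"
    using coupling_symmetric[OF G ut dm db] by simp
  then have "integral {- pi..pi} (\<lambda>x. exp (\<i> * of_real \<alpha>) / of_real (2 * sec_freq T)
      * (cnj (coupling G (\<lambda>y. u y t) x) * d x)) = 0"
    by (simp only: integral_mult_right) simp
  then show ?thesis
    unfolding cnj_field_w by (simp add: cnj_coupling u_def d_def v_def w_def mult.assoc)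
qed

lemma sigma_ess_cases:
  assumes T: "T > 0" and G: "coupling_kernel G"
    and a: "rotating_solution G \<alpha> \<Omega> T a" and sc: "self_consistent G \<alpha> \<Omega> T a"
    and \<mu>: "\<mu> \<in> sigma_ess G \<alpha> \<Omega> T a"
  shows "cmod \<mu> = 1 \<or> (\<exists>r::real. 0 < r \<and> r \<le> 1 \<and> \<mu> = of_real r)"
proof -
  have contG: "continuous_on UNIV G" using G by (simp add: coupling_kernel_def)
  interpret F: riccati_family "field_w G \<alpha> T a" "amp_u T a" "freq_ratio \<Omega> T"
    by (rule rotating_solution_family[OF T contG a])
  have main: "cmod (exp (- integral {0..T} (eta G \<alpha> \<Omega> a x))) = 1 \<or>
      (\<exists>r::real. 0 < r \<and> r \<le> 1 \<and> exp (- integral {0..T} (eta G \<alpha> \<Omega> a x)) = of_real r)"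
    if "x \<in> {- pi..pi}" for x
    unfolding integral_eta[OF T]
    by (rule periodic_riccati_multiplier[OF F.cont_wx F.ric])
       (use F.per_u[of x 0] F.orthogonal_imp_nonneg self_consistent_orthogonal[OF T G a sc] that in auto)
  \<comment> \<open>The second half of \<open>sigma_ess\<close> is the mirror image of the first,
    and the unit circle and the real interval are both invariant under conjugation.\<close>
  have conj: "exp (- integral {0..T} (\<lambda>t. cnj (eta G \<alpha> \<Omega> a x t)))
      = cnj (exp (- integral {0..T} (eta G \<alpha> \<Omega> a x)))" for x
    by (simp add: exp_cnj integral_cnj)
  from \<mu> obtain x where x: "x \<in> {- pi..pi}"
    and "\<mu> = exp (- integral {0..T} (eta G \<alpha> \<Omega> a x)) \<or> \<mu> = cnj (exp (- integral {0..T} (eta G \<alpha> \<Omega> a x)))"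
    unfolding sigma_ess_def conj by blast
  with main[OF x] show ?thesis
    by (metis complex_cnj_complex_of_real complex_mod_cnj)
qed

lemma exists_unstable_sigma_ess:
  assumes \<alpha>: "\<alpha> \<in> {- pi / 2<..<pi / 2}"
  shows "\<exists>G \<Omega> T a. coupling_kernel G \<and> T > 0 \<and> rotating_solution G \<alpha> \<Omega> T a \<and>
          (\<exists>\<mu>\<in>sigma_ess G \<alpha> \<Omega> T a. unstable \<mu>)"
proof -
  define G :: "real \<Rightarrow> real" where "G x = cos x - 1" for x
  define \<Omega> where "\<Omega> = 2 * pi * sin \<alpha>"
  define a :: "real \<Rightarrow> real \<Rightarrow> complex" where "a x t = 1" for x t
  have ker: "coupling_kernel G"
    unfolding coupling_kernel_def
  proof (intro conjI allI exI)
    show "continuous_on UNIV G" unfolding G_def by (intro continuous_intros)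
    show "G 0 \<noteq> G pi" by (simp add: G_def)
  qed (auto simp: G_def)
  have G1: "coupling G (\<lambda>y. c) x = - 2 * pi * c" for x and c :: complex
  proof -
    have "((\<lambda>y. G (x - y)) has_integral ((- sin (x - pi) - pi) - (- sin (x - (- pi)) - (- pi)))) {- pi..pi}"
      unfolding G_def
      by (rule fundamental_theorem_of_calculus)
         (auto intro!: derivative_eq_intros simp flip: has_real_derivative_iff_has_vector_derivative)
    then have "((\<lambda>y. G (x - y)) has_integral (- 2 * pi)) {- pi..pi}" by simp
    from has_integral_mult_left[OF has_integral_of_real[OF this], of c] show ?thesis
      unfolding coupling_def by (rule integral_unique[THEN trans]) simp
  qed
  have e: "exp (\<i> * of_real \<alpha>) = of_real (cos \<alpha>) + \<i> * of_real (sin \<alpha>)"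
    "exp (- \<i> * of_real \<alpha>) = of_real (cos \<alpha>) - \<i> * of_real (sin \<alpha>)"
    by (simp_all add: complex_eq_iff Re_exp Im_exp)
  have sol: "rotating_solution G \<alpha> \<Omega> 1 a"
    unfolding rotating_solution_def solves_star_def
  proof (intro conjI allI)
    fix x t :: real
    define E where "E = exp (\<i> * of_real (\<Omega> * t))"
    have EE: "E * cnj E = 1" by (simp add: E_def exp_cnj exp_minus)
    have lin: "((\<lambda>t. \<i> * of_real (\<Omega> * t)) has_vector_derivative (\<i> * of_real \<Omega>)) (at t)"
      by (auto intro!: derivative_eq_intros)
    have "((\<lambda>t. a x t * exp (\<i> * of_real (\<Omega> * t))) has_vector_derivative \<i> * of_real \<Omega> * E) (at t)"
      using has_vector_derivative_exp[OF lin] by (simp add: a_def E_def)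
    moreover have "\<i> * of_real \<Omega> * E
      = 1 / 2 * exp (- \<i> * of_real \<alpha>) * (- 2 * pi * E)
         - 1 / 2 * exp (\<i> * of_real \<alpha>) * E\<^sup>2 * (- 2 * pi * cnj E)"
    proof -
      have "E\<^sup>2 * (- 2 * pi * cnj E) = - 2 * pi * E * (E * cnj E)"
        by (simp add: power2_eq_square)
      then have "1 / 2 * exp (\<i> * of_real \<alpha>) * E\<^sup>2 * (- 2 * pi * cnj E) = - exp (\<i> * of_real \<alpha>) * pi * E"
        unfolding EE by (simp add: mult.assoc)
      then show ?thesis
        unfolding e by (simp add: \<Omega>_def algebra_simps)
    qed
    ultimately show "((\<lambda>t. a x t * exp (\<i> * of_real (\<Omega> * t))) has_vector_derivative
        (1 / 2 * exp (- \<i> * of_real \<alpha>) * coupling G (\<lambda>y. a y t * exp (\<i> * of_real (\<Omega> * t))) x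
         - 1 / 2 * exp (\<i> * of_real \<alpha>) * (a x t * exp (\<i> * of_real (\<Omega> * t)))\<^sup>2
           * coupling G (\<lambda>y. cnj (a y t * exp (\<i> * of_real (\<Omega> * t)))) x)) (at t)"
      by (simp add: a_def G1 E_def)
  qed (auto simp: a_def case_prod_unfold)
  have "eta G \<alpha> \<Omega> a 0 = (\<lambda>t. of_real (- 2 * pi * cos \<alpha>))"
    by (rule ext) (simp add: eta_def a_def G1 e \<Omega>_def algebra_simps)
  then have "exp (of_real (2 * pi * cos \<alpha>)) \<in> sigma_ess G \<alpha> \<Omega> 1 a"
    unfolding sigma_ess_def by (intro UnI1 CollectI exI[of _ 0]) simp
  moreover have "unstable (exp (of_real (2 * pi * cos \<alpha>)))"
    using cos_gt_zero_pi[of \<alpha>] \<alpha> by (simp add: unstable_def)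
  ultimately show ?thesis using ker sol zero_less_one by blast
qed

theorem mainTheorem9:
  shows
   "(\<forall>(G :: real \<Rightarrow> real) (\<alpha> :: real) (\<Omega> :: real) (T :: real) (a :: real \<Rightarrow> real \<Rightarrow> complex).
       coupling_kernel G \<and> \<alpha> \<in> {- pi / 2<..<pi / 2} \<and> T > 0 \<and>
       rotating_solution G \<alpha> \<Omega> T a \<and> self_consistent G \<alpha> \<Omega> T a \<longrightarrow>
       (\<forall>x. exp (- integral {0..T} (\<lambda>t. eta G \<alpha> \<Omega> a x t))
            = exp (- integral {0..2 * pi}
                (\<lambda>t. \<i> * of_real (freq_ratio \<Omega> T) + 2 * cnj (field_w G \<alpha> T a x t) * amp_u T a x t))) \<and>
       (\<forall>\<mu>\<in>sigma_ess G \<alpha> \<Omega> T a. cmod \<mu> = 1 \<or> (\<exists>r::real. 0 < r \<and> r \<le> 1 \<and> \<mu> = of_real r)) \<and>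
       ((\<forall>\<mu>\<in>sigma_ess G \<alpha> \<Omega> T a. \<not> unstable \<mu>) \<and>
        (monodromy_spectrum G \<alpha> \<Omega> T a \<subseteq> cball 0 1 \<longleftrightarrow>
         monodromy_spectrum G \<alpha> \<Omega> T a - sigma_ess G \<alpha> \<Omega> T a \<subseteq> cball 0 1)))
    \<and>
    (\<forall>\<alpha>::real. \<alpha> \<in> {- pi / 2<..<pi / 2} \<longrightarrow>
       (\<exists>(G :: real \<Rightarrow> real) (\<Omega> :: real) (T :: real) (a :: real \<Rightarrow> real \<Rightarrow> complex).
          coupling_kernel G \<and> T > 0 \<and> rotating_solution G \<alpha> \<Omega> T a \<and>
          (\<exists>\<mu>\<in>sigma_ess G \<alpha> \<Omega> T a. unstable \<mu>)))
    \<and>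
    (\<forall>(G :: real \<Rightarrow> real) (\<alpha> :: real) (\<Omega> :: real) (T :: real) (a :: real \<Rightarrow> real \<Rightarrow> complex).
       coupling_kernel G \<and> \<alpha> \<in> {- pi / 2<..<pi / 2} \<and> T > 0 \<and> rotating_solution G \<alpha> \<Omega> T a \<and>
       (\<exists>\<mu>\<in>sigma_ess G \<alpha> \<Omega> T a. unstable \<mu>) \<longrightarrow>
       \<not> self_consistent G \<alpha> \<Omega> T a)"
proof (intro conjI)
  have stable: "\<not> unstable \<mu>"
    if "coupling_kernel G" "T > 0" "rotating_solution G \<alpha> \<Omega> T a" "self_consistent G \<alpha> \<Omega> T a"
      "\<mu> \<in> sigma_ess G \<alpha> \<Omega> T a" for G \<alpha> \<Omega> T a \<mu>
    using sigma_ess_cases[OF that(2,1,3-5)] by (auto simp: unstable_def)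
  then have disc: "sigma_ess G \<alpha> \<Omega> T a \<subseteq> cball 0 1"
    if "coupling_kernel G" "T > 0" "rotating_solution G \<alpha> \<Omega> T a" "self_consistent G \<alpha> \<Omega> T a"
    for G \<alpha> \<Omega> T a
    using that by (force simp: unstable_def not_less)
  show "\<forall>G \<alpha> \<Omega> T a.
       coupling_kernel G \<and> \<alpha> \<in> {- pi / 2<..<pi / 2} \<and> T > 0 \<and>
       rotating_solution G \<alpha> \<Omega> T a \<and> self_consistent G \<alpha> \<Omega> T a \<longrightarrow>
       (\<forall>x. exp (- integral {0..T} (\<lambda>t. eta G \<alpha> \<Omega> a x t))
            = exp (- integral {0..2 * pi}
                (\<lambda>t. \<i> * of_real (freq_ratio \<Omega> T) + 2 * cnj (field_w G \<alpha> T a x t) * amp_u T a x t))) \<and>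
       (\<forall>\<mu>\<in>sigma_ess G \<alpha> \<Omega> T a. cmod \<mu> = 1 \<or> (\<exists>r::real. 0 < r \<and> r \<le> 1 \<and> \<mu> = of_real r)) \<and>
       ((\<forall>\<mu>\<in>sigma_ess G \<alpha> \<Omega> T a. \<not> unstable \<mu>) \<and>
        (monodromy_spectrum G \<alpha> \<Omega> T a \<subseteq> cball 0 1 \<longleftrightarrow>
         monodromy_spectrum G \<alpha> \<Omega> T a - sigma_ess G \<alpha> \<Omega> T a \<subseteq> cball 0 1))"
  proof (intro allI impI conjI ballI)
    fix G :: "real \<Rightarrow> real" and \<alpha> \<Omega> T :: real and a :: "real \<Rightarrow> real \<Rightarrow> complex"
    assume h: "coupling_kernel G \<and> \<alpha> \<in> {- pi / 2<..<pi / 2} \<and> T > 0 \<and>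
       rotating_solution G \<alpha> \<Omega> T a \<and> self_consistent G \<alpha> \<Omega> T a"
    show "exp (- integral {0..T} (\<lambda>t. eta G \<alpha> \<Omega> a x t))
            = exp (- integral {0..2 * pi}
                (\<lambda>t. \<i> * of_real (freq_ratio \<Omega> T) + 2 * cnj (field_w G \<alpha> T a x t) * amp_u T a x t))" for x
      using integral_eta[of T G \<alpha> \<Omega> a x] h by simp
    show "cmod \<mu> = 1 \<or> (\<exists>r::real. 0 < r \<and> r \<le> 1 \<and> \<mu> = of_real r)" if "\<mu> \<in> sigma_ess G \<alpha> \<Omega> T a" for \<mu>
      using sigma_ess_cases h that by blast
    show "\<not> unstable \<mu>" if "\<mu> \<in> sigma_ess G \<alpha> \<Omega> T a" for \<mu>
      using stable h that by blast
    \<comment> \<open>Irrelevance for instability: \<open>sigma_ess\<close> lies in the closed disc,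
      so removing it from the spectrum does not change whether the spectrum fits into the
      disc.\<close>
    show "monodromy_spectrum G \<alpha> \<Omega> T a \<subseteq> cball 0 1 \<longleftrightarrow>
         monodromy_spectrum G \<alpha> \<Omega> T a - sigma_ess G \<alpha> \<Omega> T a \<subseteq> cball 0 1"
      using disc h by blast
  qed
  show "\<forall>\<alpha>::real. \<alpha> \<in> {- pi / 2<..<pi / 2} \<longrightarrow>
       (\<exists>(G :: real \<Rightarrow> real) (\<Omega> :: real) (T :: real) (a :: real \<Rightarrow> real \<Rightarrow> complex).
          coupling_kernel G \<and> T > 0 \<and> rotating_solution G \<alpha> \<Omega> T a \<and>
          (\<exists>\<mu>\<in>sigma_ess G \<alpha> \<Omega> T a. unstable \<mu>))"
    using exists_unstable_sigma_ess by blast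
  show "\<forall>(G :: real \<Rightarrow> real) (\<alpha> :: real) (\<Omega> :: real) (T :: real) (a :: real \<Rightarrow> real \<Rightarrow> complex).
       coupling_kernel G \<and> \<alpha> \<in> {- pi / 2<..<pi / 2} \<and> T > 0 \<and> rotating_solution G \<alpha> \<Omega> T a \<and>
       (\<exists>\<mu>\<in>sigma_ess G \<alpha> \<Omega> T a. unstable \<mu>) \<longrightarrow>
       \<not> self_consistent G \<alpha> \<Omega> T a"
    using stable by blast
qed

end
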